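(* For every integer $d \geq 1$, $c_d \geq \frac{7-4\sqrt{3}}{75}$, where \[ c_d = \inf\, \mathbb{P}\left(\left|\sum_{j=1}^n A_j\xi_j\right| \geq \sqrt{\mathbb{E}\left|\sum_{j=1}^n A_j\xi_j\right|^2}\right), \] the infimum being over all integers $n \geq 1$ and all $d \times d$ real matrices $A_1, \dots, A_n$.
   Context: For a fixed integer $d \geq 1$, $\xi_1, \xi_2, \dots$ are independent random vectors in $\mathbb{R}^d$, each uniformly distributed on the unit sphere $S^{d-1} = \{x \in \mathbb{R}^d : |x| = 1\}$, where $|\cdot|$ is the Euclidean norm (for $d=1$ these are independent random signs taking values $\pm 1$ with probability $\frac12$). *)

theory Defs
  imports "HOL-Probability.Probability"
begin

text \<open>
  The uniform distribution on the unit sphere of \<open>\<real>\<^sup>d\<close> is the normalised surface measure, taken here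
  as the normalised cone measure: the proportion of the unit ball lying in the cone over a set of
  directions.  The value of the projection at the origin is irrelevant.  The lemmas below
  show that it is a rotation-invariant probability measure on the sphere, and in dimension one
  the law of a random sign.
\<close>

definition uniform_sphere :: "(real ^ 'd) measure" where
  "uniform_sphere = distr (uniform_measure lborel (ball 0 1)) borel (\<lambda>x. x /\<^sub>R norm x)"

lemma sets_uniform_sphere [simp, measurable_cong]: "sets uniform_sphere = sets borel"
  and space_uniform_sphere [simp]: "space uniform_sphere = UNIV"
  by (simp_all add: uniform_sphere_def)

lemma emeasure_unit_ball_nonzero: "emeasure lborel (ball (0::real^'d) 1) \<noteq> 0"
proof -
  have "measure lborel (ball (0::real^'d) 1) > 0"
    using content_ball_pos[of 1 "0::real^'d"] by simp
  then show ?thesis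
    by (auto simp: measure_def)
qed

lemma prob_space_uniform_sphere: "prob_space (uniform_sphere :: (real^'d) measure)"
  unfolding uniform_sphere_def
  by (intro prob_space.prob_space_distr prob_space_uniform_measure emeasure_unit_ball_nonzero)
     (use emeasure_lborel_ball_finite[of "0::real^'d" 1] in auto)

lemma AE_uniform_sphere: "AE x in uniform_sphere. x \<in> sphere (0::real^'d) 1"
proof -
  have "AE x in lborel. x \<noteq> (0::real^'d)"
    by (intro AE_lborel_singleton)
  then have "AE x in uniform_measure lborel (ball (0::real^'d) 1). norm (x /\<^sub>R norm x) = 1"
    by (intro AE_uniform_measureI) auto
  then show ?thesis
    unfolding uniform_sphere_def by (subst AE_distr_iff) auto
qed

lemma emeasure_uniform_sphere:
  fixes B :: "(real^'d) set"
  assumes [measurable]: "B \<in> sets borel"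
  shows "emeasure uniform_sphere B =
    emeasure lborel (ball 0 1 \<inter> {x. x /\<^sub>R norm x \<in> B}) / emeasure lborel (ball (0::real^'d) 1)"
proof -
  have [measurable]: "{x::real^'d. x /\<^sub>R norm x \<in> B} \<in> sets borel"
    by measurable
  show ?thesis
    unfolding uniform_sphere_def by (subst emeasure_distr) (auto simp: vimage_def)
qed

lemma nn_integral_lborel_reflect:
  fixes f :: "'a::euclidean_space \<Rightarrow> ennreal"
  assumes [measurable]: "f \<in> borel_measurable borel"
  shows "(\<integral>\<^sup>+x. f (t - x) \<partial>lborel) = (\<integral>\<^sup>+x. f x \<partial>lborel)"
proof -
  have "lborel = density (distr lborel borel (\<lambda>x::'a. t + (-1) *\<^sub>R x)) (\<lambda>_. ennreal (\<bar>-1\<bar> ^ DIM('a)))"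
    by (rule lborel_affine) simp
  then have "lborel = distr lborel borel (\<lambda>x::'a. t - x)"
    by (simp add: density_1)
  then have "(\<integral>\<^sup>+x. f x \<partial>lborel) = (\<integral>\<^sup>+x. f x \<partial>distr lborel borel (\<lambda>x::'a. t - x))"
    by simp
  also have "\<dots> = (\<integral>\<^sup>+x. f (t - x) \<partial>lborel)"
    by (subst nn_integral_distr) auto
  finally show ?thesis by simp
qed

lemma nn_integral_lborel_shift:
  fixes f :: "'a::euclidean_space \<Rightarrow> ennreal"
  assumes [measurable]: "f \<in> borel_measurable borel"
  shows "(\<integral>\<^sup>+x. f (x - t) \<partial>lborel) = (\<integral>\<^sup>+x. f x \<partial>lborel)"
  using nn_integral_lborel_reflect[of "\<lambda>x. f (- x)" t] nn_integral_lborel_reflect[of f 0] by simp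

lemma borel_measurable_orthogonal_transformation:
  fixes T :: "'a::euclidean_space \<Rightarrow> 'a"
  assumes "orthogonal_transformation T"
  shows "T \<in> borel_measurable borel"
  using orthogonal_transformation_linear[OF assms]
  by (intro borel_measurable_continuous_onI linear_continuous_on)
     (simp add: linear_conv_bounded_linear)

text \<open>
  Proved by the uniqueness argument for Haar measure, because the library's theorems on linear
  images ask for a well-ordered index type.
\<close>

lemma emeasure_lborel_orthogonal_vimage:
  fixes T :: "'a::euclidean_space \<Rightarrow> 'a"
  assumes T: "orthogonal_transformation T" and A [measurable]: "A \<in> sets borel"
  shows "emeasure lborel (T -` A) = emeasure lborel A"
proof -
  have lin: "linear T" using T by (rule orthogonal_transformation_linear)
  note Tm [measurable] = borel_measurable_orthogonal_transformation[OF T]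
  have nT: "norm (T x) = norm x" for x
    using T by (rule orthogonal_transformation_norm)
  have surj: "T (inv T y) = y" for y
    using orthogonal_transformation_surj[OF T] by (rule surj_f_inv_f)
  define K where "K = ball (0::'a) 1"
  have [measurable]: "K \<in> sets borel" by (simp add: K_def)
  have Ksym: "indicator K (x - y) = (indicator K (y - x) :: ennreal)" for x y
    by (simp add: K_def indicator_def norm_minus_commute)
  have KT: "indicator K (T x) = (indicator K x :: ennreal)" for x
    by (simp add: K_def indicator_def nT)
  have TA: "T -` A \<in> sets borel"
    using measurable_sets[OF Tm A] by simp
  have "emeasure lborel (T -` A) * emeasure lborel K =
      (\<integral>\<^sup>+x. indicator (T -` A) x \<partial>lborel) * emeasure lborel K"
    using TA by simp
  also have "\<dots> = (\<integral>\<^sup>+x. indicator A (T x) * emeasure lborel K \<partial>lborel)"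
    by (simp add: nn_integral_multc indicator_vimage)
  also have "\<dots> = (\<integral>\<^sup>+x. indicator A (T x) * (\<integral>\<^sup>+y. indicator K (y - T x) \<partial>lborel) \<partial>lborel)"
    by (simp add: nn_integral_lborel_shift[of "indicator K"])
  also have "\<dots> = (\<integral>\<^sup>+x. (\<integral>\<^sup>+y. indicator A (T x) * indicator K (y - T x) \<partial>lborel) \<partial>lborel)"
    by (simp add: nn_integral_cmult)
  also have "\<dots> = (\<integral>\<^sup>+y. (\<integral>\<^sup>+x. indicator A (T x) * indicator K (y - T x) \<partial>lborel) \<partial>lborel)"
    by (rule lborel_pair.Fubini'[symmetric]) measurable
  also have "\<dots> = (\<integral>\<^sup>+y. (\<integral>\<^sup>+x. indicator A (y - T x) * indicator K (T x) \<partial>lborel) \<partial>lborel)"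
  proof (rule nn_integral_cong)
    fix y
    show "(\<integral>\<^sup>+x. indicator A (T x) * indicator K (y - T x) \<partial>lborel) =
        (\<integral>\<^sup>+x. indicator A (y - T x) * indicator K (T x) \<partial>(lborel :: 'a measure))"
      using nn_integral_lborel_reflect[of "\<lambda>x. indicator A (T x) * indicator K (y - T x)" "inv T y"]
      by (simp add: linear_diff[OF lin] surj)
  qed
  also have "\<dots> = (\<integral>\<^sup>+x. (\<integral>\<^sup>+y. indicator A (y - T x) * indicator K (T x) \<partial>lborel) \<partial>lborel)"
    by (rule lborel_pair.Fubini') measurable
  also have "\<dots> = (\<integral>\<^sup>+x. emeasure lborel A * indicator K x \<partial>lborel)"
    by (simp add: nn_integral_multc nn_integral_lborel_shift[of "indicator A"] KT)
  also have "\<dots> = emeasure lborel A * emeasure lborel K"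
    by (simp add: nn_integral_cmult)
  finally have *: "emeasure lborel (T -` A) * emeasure lborel K = emeasure lborel A * emeasure lborel K" .
  have "measure lborel K > 0"
    using content_ball_pos[of 1 "0::'a"] by (simp add: K_def)
  then have "emeasure lborel K \<noteq> 0"
    by (auto simp: measure_def)
  moreover have "emeasure lborel K \<noteq> \<infinity>"
    using emeasure_lborel_ball_finite[of "0::'a" 1] by (simp add: K_def)
  ultimately show ?thesis
    using * by (simp add: mult.commute[of _ "emeasure lborel K"] ennreal_mult_cancel_left)
qed

lemma uniform_sphere_rotation_invariant:
  fixes T :: "real^'d \<Rightarrow> real^'d"
  assumes T: "orthogonal_transformation T"
  shows "distr uniform_sphere borel T = uniform_sphere"
proof (rule measure_eqI)
  fix B :: "(real^'d) set" assume "B \<in> sets (distr uniform_sphere borel T)"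
  then have B [measurable]: "B \<in> sets borel" by simp
  have lin: "linear T" using T by (rule orthogonal_transformation_linear)
  note Tm [measurable] = borel_measurable_orthogonal_transformation[OF T]
  have TB: "T -` B \<in> sets borel"
    using measurable_sets[OF Tm B] by simp
  have nT: "norm (T x) = norm x" for x
    using T by (rule orthogonal_transformation_norm)
  let ?R = "ball 0 1 \<inter> {x::real^'d. x /\<^sub>R norm x \<in> B}"
  have "ball 0 1 \<inter> {x. x /\<^sub>R norm x \<in> T -` B} = T -` ?R"
    by (auto simp: nT linear_cmul[OF lin])
  moreover have "?R \<in> sets borel"
    by measurable
  then have "emeasure lborel (T -` ?R) = emeasure lborel ?R"
    by (rule emeasure_lborel_orthogonal_vimage[OF T])
  ultimately have "emeasure uniform_sphere (T -` B) = emeasure uniform_sphere B"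
    by (simp only: emeasure_uniform_sphere TB B)
  then show "emeasure (distr uniform_sphere borel T) B = emeasure uniform_sphere B"
    by (simp add: emeasure_distr)
qed simp

lemma uniform_sphere_dim_1:
  fixes x :: "real^'d"
  assumes d: "CARD('d) = 1" and x: "norm x = 1"
  shows "measure uniform_sphere {x} = 1 / 2"
proof -
  interpret prob_space "uniform_sphere :: (real^'d) measure"
    by (rule prob_space_uniform_sphere)
  obtain i :: 'd where i: "UNIV = {i}"
    using d by (metis card_1_singletonE)
  have nrm: "norm y = \<bar>y $ i\<bar>" for y :: "real^'d"
    by (simp add: norm_vec_def i)
  have eq: "y = z \<longleftrightarrow> y $ i = z $ i" for y z :: "real^'d"
    using i by (auto simp: vec_eq_iff)
  have sphere: "sphere 0 1 = {x, - x}"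
    using x by (auto simp: nrm eq)
  have ne: "x \<noteq> - x"
    using x by (auto simp: nrm eq)
  have "orthogonal_transformation (uminus :: real^'d \<Rightarrow> _)"
    by (auto simp: orthogonal_transformation_def linear_uminus)
  then have "measure uniform_sphere {x} = measure (distr uniform_sphere borel uminus) {x}"
    by (simp add: uniform_sphere_rotation_invariant)
  also have "\<dots> = prob (uminus -` {x})"
    by (subst measure_distr) auto
  also have "uminus -` {x} = {- x}"
    by (auto simp: eq)
  finally have "prob {x} = prob {- x}" .
  moreover have "prob {x, - x} = 1"
    using AE_uniform_sphere[where 'd = 'd] unfolding sphere by (subst prob_eq_1) auto
  moreover have "prob {x, - x} = prob {x} + prob {- x}"
    using ne finite_measure_Union[of "{x}" "{- x}"] by (simp add: insert_commute)
  ultimately show ?thesis by simp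
qed

text \<open>
  The constant \<open>c\<^sub>d\<close>; only the matrices \<open>A 1, \<dots>, A n\<close> enter.  The set of probabilities is nonempty
  and bounded below by zero, so the real infimum is the genuine one.
\<close>

definition c_const :: "'a measure \<Rightarrow> (nat \<Rightarrow> 'a \<Rightarrow> real ^ 'd) \<Rightarrow> real" where
  "c_const M \<xi> =
    (INF (n, A) \<in> {1..} \<times> (UNIV :: (nat \<Rightarrow> real ^ 'd ^ 'd) set).
      measure M {\<omega> \<in> space M.
        norm (\<Sum>j=1..n. A j *v \<xi> j \<omega>) \<ge>
          sqrt (\<integral>\<omega>'. (norm (\<Sum>j=1..n. A j *v \<xi> j \<omega>'))\<^sup>2 \<partial>M)})"

lemma ex_indep_uniform_sphere:
  "\<exists>(M :: (nat \<Rightarrow> real ^ 'd) measure) (\<xi> :: nat \<Rightarrow> _ \<Rightarrow> _). prob_space M \<and>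
     prob_space.indep_vars M (\<lambda>_. borel :: (real ^ 'd) measure) \<xi> {1..} \<and>
     (\<forall>j\<ge>1. distr M borel (\<xi> j) = uniform_sphere)"
proof -
  let ?U = "uniform_sphere :: (real^'d) measure"
  let ?M = "PiM (UNIV :: nat set) (\<lambda>_. ?U)"
  let ?X = "\<lambda>j \<omega>. \<omega> j :: real^'d"
  interpret P: prob_space ?M
    by (intro prob_space_PiM prob_space_uniform_sphere)
  have D: "distr ?M borel (?X j) = ?U" for j
  proof -
    have "distr ?M borel (?X j) = distr ?M ?U (?X j)"
      by (rule distr_cong) auto
    also have "\<dots> = ?U"
      by (rule distr_PiM_component) (auto intro: prob_space_uniform_sphere)
    finally show ?thesis .
  qed
  have m: "?X j \<in> measurable ?M borel" for j
    using measurable_component_singleton[of j UNIV "\<lambda>_. ?U"]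
    by (simp add: measurable_cong_sets[OF refl sets_uniform_sphere])
  have "P.indep_vars (\<lambda>_. borel) ?X UNIV"
  proof (subst P.indep_vars_iff_distr_eq_PiM')
    show "distr ?M (Pi\<^sub>M UNIV (\<lambda>_. borel)) (\<lambda>x. \<lambda>i\<in>UNIV. x i) =
      Pi\<^sub>M UNIV (\<lambda>i. distr ?M borel (?X i))"
      unfolding D restrict_UNIV by (intro distr_id2 sets_PiM_cong) auto
  qed (use m in auto)
  then have "P.indep_vars (\<lambda>_. borel) ?X {1..}"
    by (rule P.indep_vars_subset) auto
  then show ?thesis
    using D P.prob_space_axioms by blast
qed

end

theory Submission
  imports Defs
begin

text \<open>
  A centred variable \<open>X\<close> with \<open>E X\<^sup>4 \<le> C (E X\<^sup>2)\<^sup>2\<close> satisfies \<open>P (X \<ge> 0) \<ge> (2 \<surd>3 - 3) / C\<close>, because the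
  quartic \<open>2 t + 3 t\<^sup>2 - t\<^sup>4\<close> is nonpositive for \<open>t \<le> 0\<close> and bounded for \<open>t \<ge> 0\<close>.

  The vectors \<open>\<xi>\<^sub>j\<close> may be multiplied by independent signs \<open>\<epsilon>\<^sub>j\<close> without changing the joint law. Then
  \<open>|\<Sum> \<epsilon>\<^sub>j A\<^sub>j \<xi>\<^sub>j|\<^sup>2 - E |\<Sum> A\<^sub>j \<xi>\<^sub>j|\<^sup>2 = Y + Z\<close>, where \<open>Y = \<Sum> (|A\<^sub>j \<xi>\<^sub>j|\<^sup>2 - E |A\<^sub>j \<xi>\<^sub>j|\<^sup>2)\<close> does not depend on the
  signs and \<open>Z\<close> is, for fixed \<open>\<xi>\<close>, a Rademacher chaos of order two. Both satisfy the fourth-moment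
  hypothesis with \<open>C = 15\<close>: for \<open>Z\<close> by induction on the number of signs, for \<open>Y\<close> by independence and
  the moments of a traceless quadratic form on the sphere, which rotation invariance provides through
  integration by parts. Hence \<open>P (Y + Z \<ge> 0) \<ge> P (Y \<ge> 0, Z \<ge> 0) \<ge> ((2 \<surd>3 - 3) / 15)\<^sup>2 = (7 - 4 \<surd>3) / 75\<close>.
\<close>

section \<open>A fourth-moment lower bound for the probability of the positive part\<close>

text \<open>The quartic has a double root at \<open>t = -1\<close>, where it touches zero from
  below. This makes it usable as a minorant, up to scaling, of the indicator of
  \<open>t \<ge> 0\<close>.\<close>

lemma quartic_nonpos:
  fixes t :: real
  assumes "t \<le> 0"
  shows "2 * t + 3 * t\<^sup>2 - t ^ 4 \<le> 0"
proof -
  have "2 * t + 3 * t\<^sup>2 - t ^ 4 = t * ((2 - t) * (t + 1)\<^sup>2)"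
    by algebra
  also have "\<dots> \<le> 0"
    using assms by (intro mult_nonpos_nonneg) auto
  finally show ?thesis .
qed

lemma quartic_le:
  fixes t :: real
  assumes "t \<ge> 0"
  shows "2 * t + 3 * t\<^sup>2 - t ^ 4 \<le> 3 / 4 * (2 * sqrt 3 + 3)"
proof -
  define r where "r = sqrt (3::real)"
  \<comment> \<open>the maximiser of the quartic on \<open>t \<ge> 0\<close>, a root of \<open>2 u\<^sup>2 - 2 u - 1\<close>\<close>
  define u where "u = (1 + r) / 2"
  have r: "r\<^sup>2 = 3" "r \<ge> 0"
    by (auto simp: r_def)
  have r_u: "r = 2 * u - 1"
    by (simp add: u_def field_simps)
  have u: "2 * u\<^sup>2 - 2 * u - 1 = 0"
    using r(1) unfolding r_u by (simp add: power2_eq_square algebra_simps)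
  \<comment> \<open>The gap below the maximum has a double zero at \<open>u\<close>, and its
    cofactor is nonnegative for \<open>t \<ge> 0\<close>. Adding a multiple of
    \<open>2 u^2 - 2 u - 1\<close>, which is zero, turns the next equation into a polynomial
    identity in \<open>t\<close> and \<open>u\<close> without radicals.\<close>
  have "0 \<le> (t - u)\<^sup>2 * (2 * t\<^sup>2 + 4 * u * t + 3 * r)"
    using assms r by (auto simp: u_def)
  also have "(t - u)\<^sup>2 * (2 * t\<^sup>2 + 4 * u * t + 3 * r) =
      3 / 2 * (2 * r + 3) - 2 * (2 * t + 3 * t\<^sup>2 - t ^ 4)
      + (2 * u\<^sup>2 - 2 * u - 1) * ((2 * u - 4) * t - 3 * t\<^sup>2 + 3 * u + 3 / 2)"
    unfolding r_u by (simp add: power2_eq_square power4_eq_xxxx algebra_simps)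
  finally show ?thesis
    unfolding u by (simp add: r_def)
qed

text \<open>The quartic divided by its maximum lies below the indicator of the nonnegative
  half-line. Evaluated at \<open>X / \<nu>\<close> and integrated, its linear term vanishes and only
  the second and fourth moments remain; \<open>\<nu>\<close> is then chosen optimally.\<close>

lemma (in prob_space) prob_nonneg_ge_fourth_moment:
  fixes X :: "'a \<Rightarrow> real"
  assumes X [measurable]: "random_variable borel X"
    and int: "integrable M X" "integrable M (\<lambda>x. (X x)\<^sup>2)" "integrable M (\<lambda>x. X x ^ 4)"
    and mean: "expectation X = 0"
    and fourth: "expectation (\<lambda>x. X x ^ 4) \<le> C * (expectation (\<lambda>x. (X x)\<^sup>2))\<^sup>2"
    and C: "C \<ge> 1"
  shows "prob {x \<in> space M. X x \<ge> 0} \<ge> (2 * sqrt 3 - 3) / C"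
\<comment> \<open>Zero variance forces \<open>X = 0\<close> almost surely; there is no scale
  \<open>\<nu>\<close> then, but the probability is 1 and the claimed bound is at most 1.\<close>
proof (cases "expectation (\<lambda>x. (X x)\<^sup>2) = 0")
  case True
  then have "AE x in M. X x \<ge> 0"
    using int(2) by (subst (asm) integral_nonneg_eq_0_iff_AE) auto
  then have "prob {x \<in> space M. X x \<ge> 0} = 1"
    by (subst prob_Collect_eq_1) auto
  moreover have "sqrt 3 \<le> (2::real)"
    by (rule real_le_lsqrt) auto
  then have "2 * sqrt 3 - 3 \<le> C"
    using C by linarith
  ultimately show ?thesis
    using C by simp
next
  case False
  define V where "V = expectation (\<lambda>x. (X x)\<^sup>2)"
  have V: "V > 0"
    using False by (auto simp: V_def less_le intro: integral_nonneg_AE)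
  \<comment> \<open>this scale maximises \<open>3 V / \<nu>\<^sup>2 - C V\<^sup>2 / \<nu>\<^sup>4\<close>\<close>
  define \<nu> where "\<nu> = sqrt (2 * C * V / 3)"
  have \<nu>: "\<nu>\<^sup>2 = 2 * C * V / 3" "\<nu> > 0"
    using V C by (auto simp: \<nu>_def)
  \<comment> \<open>The reciprocal of the maximum of the quartic, because
    \<open>(2 * sqrt 3 - 3) * (2 * sqrt 3 + 3) = 3\<close>.\<close>
  define c :: real where "c = 4 / 9 * (2 * sqrt 3 - 3)"
  have sq3: "sqrt 3 > (3/2::real)"
    by (rule real_less_rsqrt) (simp add: power2_eq_square)
  then have c: "c > 0" by (simp add: c_def)
  have c1: "c * (3 / 4 * (2 * sqrt 3 + 3)) = 1"
    by (simp add: c_def algebra_simps)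
  have pt: "c * (2 * t + 3 * t\<^sup>2 - t ^ 4) \<le> (if t \<ge> 0 then 1 else 0)" for t :: real
  proof (cases "t \<ge> 0")
    case True
    have "c * (2 * t + 3 * t\<^sup>2 - t ^ 4) \<le> c * (3 / 4 * (2 * sqrt 3 + 3))"
      using quartic_le[OF True] c by (intro mult_left_mono) auto
    then show ?thesis
      using True c1 by simp
  next
    case False
    then show ?thesis
      using mult_nonneg_nonpos[OF less_imp_le[OF c] quartic_nonpos[of t]] by simp
  qed
  have le: "c * (2 / \<nu> * X x + 3 / \<nu>\<^sup>2 * (X x)\<^sup>2 - X x ^ 4 / \<nu> ^ 4)
      \<le> indicator {x \<in> space M. X x \<ge> 0} x" if "x \<in> space M" for x
    using pt[of "X x / \<nu>"] \<nu>(2) that by (auto simp: power_divide zero_le_divide_iff indicator_def)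
  have "(2 * sqrt 3 - 3) / C = c * (9 / 4 / C)"
    using C by (simp add: c_def divide_simps)
  also have "9 / 4 / C = 3 / \<nu>\<^sup>2 * V - C * V\<^sup>2 / \<nu> ^ 4"
  proof -
    have "\<nu> ^ 4 = (\<nu>\<^sup>2)\<^sup>2"
      by simp
    then show ?thesis
      using V C by (simp only: \<nu>(1)) (simp add: field_simps power2_eq_square)
  qed
  also have "c * \<dots> \<le> c * (3 / \<nu>\<^sup>2 * V - expectation (\<lambda>x. X x ^ 4) / \<nu> ^ 4)"
    using fourth c \<nu> by (intro mult_left_mono diff_left_mono divide_right_mono) (auto simp: V_def)
  also have "\<dots> = expectation (\<lambda>x. c * (2 / \<nu> * X x + 3 / \<nu>\<^sup>2 * (X x)\<^sup>2 - X x ^ 4 / \<nu> ^ 4))"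
    using int mean by (simp add: V_def)
  also have "\<dots> \<le> expectation (indicator {x \<in> space M. X x \<ge> 0})"
    using int le by (intro integral_mono) (auto simp: less_top[symmetric] intro!: integrable_real_indicator)
  also have "\<dots> = prob {x \<in> space M. X x \<ge> 0}"
    by simp
  finally show ?thesis .
qed

section \<open>Rademacher chaos\<close>

text \<open>A set \<open>s \<subseteq> J\<close> encodes the choice of signs that is \<open>1\<close> on \<open>s\<close> and \<open>- 1\<close> on \<open>J - s\<close>.\<close>

definition sign_at :: "'i set \<Rightarrow> 'i \<Rightarrow> real" where
  "sign_at s j = (if j \<in> s then 1 else - 1)"

text \<open>The expectation over independent fair signs, written as a finite sum so that induction
  on \<open>J\<close> stays elementary; \<open>integral_pmf_of_set_Pow\<close> reconnects it with
  probability.\<close>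

definition sign_avg :: "'i set \<Rightarrow> ('i set \<Rightarrow> real) \<Rightarrow> real" where
  "sign_avg J f = (\<Sum>s\<in>Pow J. f s) / 2 ^ card J"

text \<open>Generic in the vector space: it is used for the vectors \<open>v j\<close> and also for
  the scalar linear forms that the inductions on the chaos produce.\<close>

definition rad_sum :: "'i set \<Rightarrow> ('i \<Rightarrow> 'v) \<Rightarrow> 'i set \<Rightarrow> 'v::real_vector" where
  "rad_sum J v s = (\<Sum>j\<in>J. sign_at s j *\<^sub>R v j)"

text \<open>For finite \<open>J\<close> this is the off-diagonal part of the squared norm, the sum
  over \<open>j \<noteq> k\<close> of
  \<open>sign_at s j * sign_at s k * (v j \<bullet> v k)\<close>.\<close>

definition rad_chaos :: "'i set \<Rightarrow> ('i \<Rightarrow> 'v::real_inner) \<Rightarrow> 'i set \<Rightarrow> real" where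
  "rad_chaos J v s = (norm (rad_sum J v s))\<^sup>2 - (\<Sum>j\<in>J. (norm (v j))\<^sup>2)"

section \<open>Elementary rules for sign averages\<close>

lemma sign_avg_empty [simp]: "sign_avg {} f = f {}"
  by (simp add: sign_avg_def)

text \<open>Conditioning on the sign at \<open>i\<close>: the subsets of \<open>insert i J\<close>
  are the sets \<open>s\<close> and \<open>insert i s\<close> with \<open>s \<subseteq> J\<close>.
  Every induction on the number of signs rests on this.\<close>

lemma sign_avg_insert:
  assumes "finite J" "i \<notin> J"
  shows "sign_avg (insert i J) f = sign_avg J (\<lambda>s. (f s + f (insert i s)) / 2)"
proof -
  have "(\<Sum>s\<in>Pow (insert i J). f s) = (\<Sum>s\<in>Pow J. f s) + (\<Sum>s\<in>insert i ` Pow J. f s)"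
    unfolding Pow_insert using assms by (intro sum.union_disjoint) auto
  also have "(\<Sum>s\<in>insert i ` Pow J. f s) = (\<Sum>s\<in>Pow J. f (insert i s))"
  proof -
    have "inj_on (insert i) (Pow J)"
      using assms by (auto simp: inj_on_def)
    then show ?thesis
      by (simp add: sum.reindex)
  qed
  finally show ?thesis
    using assms by (simp add: sign_avg_def sum.distrib flip: sum_divide_distrib)
qed

lemma sign_avg_cong: "(\<And>s. s \<subseteq> J \<Longrightarrow> f s = g s) \<Longrightarrow> sign_avg J f = sign_avg J g"
  by (simp add: sign_avg_def)

lemma sign_avg_add [simp]: "sign_avg J (\<lambda>s. f s + g s) = sign_avg J f + sign_avg J g"
  by (simp add: sign_avg_def sum.distrib add_divide_distrib)

lemma sign_avg_diff [simp]: "sign_avg J (\<lambda>s. f s - g s) = sign_avg J f - sign_avg J g"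
  by (simp add: sign_avg_def sum_subtractf diff_divide_distrib)

lemma sign_avg_cmult [simp]: "sign_avg J (\<lambda>s. c * f s) = c * sign_avg J f"
  by (simp add: sign_avg_def flip: sum_distrib_left)

lemma sign_avg_const [simp]: "finite J \<Longrightarrow> sign_avg J (\<lambda>s. c) = c"
  by (simp add: sign_avg_def card_Pow)

lemma sign_avg_nonneg: "(\<And>s. 0 \<le> f s) \<Longrightarrow> 0 \<le> sign_avg J f"
  by (simp add: sign_avg_def sum_nonneg)

lemma sign_avg_Cauchy_Schwarz:
  "(sign_avg J (\<lambda>s. f s * g s))\<^sup>2 \<le> sign_avg J (\<lambda>s. (f s)\<^sup>2) * sign_avg J (\<lambda>s. (g s)\<^sup>2)"
  using Cauchy_Schwarz_ineq_sum[of f g "Pow J"]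
  by (simp add: sign_avg_def power_divide field_simps power2_eq_square)

lemma rad_sum_empty [simp]: "rad_sum {} v s = 0"
  by (simp add: rad_sum_def)

section \<open>Recursion on the number of signs\<close>

lemma rad_chaos_empty [simp]: "rad_chaos {} v s = 0"
  by (simp add: rad_chaos_def)

lemma rad_sum_insert:
  assumes "finite J" "i \<notin> J" "s \<subseteq> J"
  shows "rad_sum (insert i J) v s = rad_sum J v s - v i"
    and "rad_sum (insert i J) v (insert i s) = rad_sum J v s + v i"
proof -
  have "(\<Sum>j\<in>J. sign_at (insert i s) j *\<^sub>R v j) = (\<Sum>j\<in>J. sign_at s j *\<^sub>R v j)"
    using assms by (intro sum.cong) (auto simp: sign_at_def)
  then show "rad_sum (insert i J) v (insert i s) = rad_sum J v s + v i"
    using assms by (simp add: rad_sum_def sign_at_def)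
  show "rad_sum (insert i J) v s = rad_sum J v s - v i"
    using assms by (auto simp: rad_sum_def sign_at_def)
qed

text \<open>Expanding the squared norm, the new diagonal term \<open>(norm (v i))\<^sup>2\<close>
  cancels against the one subtracted in the chaos. What remains is a linear form in the old signs,
  multiplied by the new sign.\<close>

lemma rad_chaos_insert:
  fixes v :: "'i \<Rightarrow> 'v::real_inner"
  assumes "finite J" "i \<notin> J" "s \<subseteq> J"
  defines "m \<equiv> \<lambda>j. 2 * (v i \<bullet> v j)"
  shows "rad_chaos (insert i J) v s = rad_chaos J v s - rad_sum J m s"
    and "rad_chaos (insert i J) v (insert i s) = rad_chaos J v s + rad_sum J m s"
proof -
  have m: "rad_sum J m s = 2 * (v i \<bullet> rad_sum J v s)"
    by (simp add: m_def rad_sum_def inner_sum_right sum_distrib_left mult_ac)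
  show "rad_chaos (insert i J) v s = rad_chaos J v s - rad_sum J m s"
    "rad_chaos (insert i J) v (insert i s) = rad_chaos J v s + rad_sum J m s"
    using assms unfolding m rad_chaos_def rad_sum_insert[OF assms(1-3)]
    by (simp_all add: power2_norm_eq_inner inner_diff inner_add inner_commute)
qed

lemma sign_avg_insert_sums:
  fixes l m :: "'i \<Rightarrow> real"
  assumes "finite J" "i \<notin> J"
  shows "sign_avg (insert i J) (\<lambda>s. g (rad_sum (insert i J) l s) (rad_sum (insert i J) m s)) =
    sign_avg J (\<lambda>s. (g (rad_sum J l s - l i) (rad_sum J m s - m i) +
      g (rad_sum J l s + l i) (rad_sum J m s + m i)) / 2)"
  unfolding sign_avg_insert[OF assms] by (rule sign_avg_cong) (simp add: rad_sum_insert assms)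

text \<open>The arbitrary \<open>g\<close> makes every mixed moment of a chaos and a linear form an
  instance; \<open>l = 0\<close> is inserted when only the chaos matters.\<close>

lemma sign_avg_insert_chaos:
  fixes l :: "'i \<Rightarrow> real" and v :: "'i \<Rightarrow> 'v::real_inner"
  assumes "finite J" "i \<notin> J"
  defines "m \<equiv> \<lambda>j. 2 * (v i \<bullet> v j)"
  shows "sign_avg (insert i J) (\<lambda>s. g (rad_chaos (insert i J) v s) (rad_sum (insert i J) l s)) =
    sign_avg J (\<lambda>s. (g (rad_chaos J v s - rad_sum J m s) (rad_sum J l s - l i) +
      g (rad_chaos J v s + rad_sum J m s) (rad_sum J l s + l i)) / 2)"
  unfolding sign_avg_insert[OF assms(1,2)] m_def
  by (rule sign_avg_cong) (simp add: rad_sum_insert rad_chaos_insert assms)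

section \<open>Moments of linear forms in the signs\<close>

lemma sign_avg_mult_rad_sum_insert:
  fixes l m :: "'i \<Rightarrow> real"
  assumes "finite J" "i \<notin> J"
  shows "sign_avg (insert i J) (\<lambda>s. rad_sum (insert i J) l s * rad_sum (insert i J) m s) =
    sign_avg J (\<lambda>s. rad_sum J l s * rad_sum J m s) + l i * m i"
proof -
  have *: "((a - c) * (b - d) + (a + c) * (b + d)) / 2 = a * b + c * d" for a b c d :: real
    by (simp add: algebra_simps)
  show ?thesis
    unfolding sign_avg_insert_sums[OF assms, of "\<lambda>x y. x * y"] *
    using assms by simp
qed

lemma sign_avg_rad_sum_sq_insert:
  fixes l :: "'i \<Rightarrow> real"
  assumes "finite J" "i \<notin> J"
  shows "sign_avg (insert i J) (\<lambda>s. (rad_sum (insert i J) l s)\<^sup>2) =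
    sign_avg J (\<lambda>s. (rad_sum J l s)\<^sup>2) + (l i)\<^sup>2"
  using sign_avg_mult_rad_sum_insert[OF assms, of l l] by (simp add: power2_eq_square)

text \<open>For Gaussian coefficients Isserlis' formula gives equality. A sign has fourth moment 1
  in place of 3, so each induction step has a slack of twice
  \<open>(l i * m i)\<^sup>2\<close>.\<close>

lemma sign_avg_rad_sums_sq_mult_sq_le:
  fixes l m :: "'i \<Rightarrow> real"
  assumes "finite J"
  shows "sign_avg J (\<lambda>s. (rad_sum J l s)\<^sup>2 * (rad_sum J m s)\<^sup>2) \<le>
    sign_avg J (\<lambda>s. (rad_sum J l s)\<^sup>2) * sign_avg J (\<lambda>s. (rad_sum J m s)\<^sup>2) +
    2 * (sign_avg J (\<lambda>s. rad_sum J l s * rad_sum J m s))\<^sup>2"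
  using assms
proof (induction J rule: finite_induct)
  case empty
  then show ?case by simp
next
  case (insert i J)
  let ?L = "rad_sum J l" and ?M = "rad_sum J m"
  have *: "((a - c)\<^sup>2 * (b - d)\<^sup>2 + (a + c)\<^sup>2 * (b + d)\<^sup>2) / 2 =
      a\<^sup>2 * b\<^sup>2 + d\<^sup>2 * a\<^sup>2 + c\<^sup>2 * b\<^sup>2 + 4 * c * d * (a * b) + c\<^sup>2 * d\<^sup>2" for a b c d :: real
    by (simp add: power2_eq_square algebra_simps)
  have "sign_avg (insert i J) (\<lambda>s. (rad_sum (insert i J) l s)\<^sup>2 * (rad_sum (insert i J) m s)\<^sup>2) =
      sign_avg J (\<lambda>s. (?L s)\<^sup>2 * (?M s)\<^sup>2) + (m i)\<^sup>2 * sign_avg J (\<lambda>s. (?L s)\<^sup>2)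
      + (l i)\<^sup>2 * sign_avg J (\<lambda>s. (?M s)\<^sup>2)
      + 4 * l i * m i * sign_avg J (\<lambda>s. ?L s * ?M s) + (l i)\<^sup>2 * (m i)\<^sup>2"
    unfolding sign_avg_insert_sums[OF insert.hyps(1,2), of "\<lambda>x y. x\<^sup>2 * y\<^sup>2"] *
    using insert.hyps by simp
  also have "\<dots> \<le> (sign_avg J (\<lambda>s. (?L s)\<^sup>2) + (l i)\<^sup>2) * (sign_avg J (\<lambda>s. (?M s)\<^sup>2) + (m i)\<^sup>2)
      + 2 * (sign_avg J (\<lambda>s. ?L s * ?M s) + l i * m i)\<^sup>2"
  proof -
    have "x + d\<^sup>2 * a + c\<^sup>2 * b + 4 * c * d * e + c\<^sup>2 * d\<^sup>2 \<le>
        (a + c\<^sup>2) * (b + d\<^sup>2) + 2 * (e + c * d)\<^sup>2" if "x \<le> a * b + 2 * e\<^sup>2" for x a b c d e :: real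
    proof -
      have "(a + c\<^sup>2) * (b + d\<^sup>2) + 2 * (e + c * d)\<^sup>2 =
          a * b + 2 * e\<^sup>2 + d\<^sup>2 * a + c\<^sup>2 * b + 4 * c * d * e + c\<^sup>2 * d\<^sup>2 + 2 * (c * d)\<^sup>2"
        by algebra
      moreover have "0 \<le> (c * d)\<^sup>2"
        by simp
      ultimately show ?thesis
        using that by linarith
    qed
    then show ?thesis
      using insert.IH .
  qed
  finally show ?case
    using insert.hyps
    by (simp add: sign_avg_mult_rad_sum_insert sign_avg_rad_sum_sq_insert)
qed

section \<open>Moments of the chaos\<close>

lemma sign_avg_rad_chaos:
  assumes "finite J"
  shows "sign_avg J (rad_chaos J v) = 0"
  using assms
proof (induction J rule: finite_induct)
  case (insert i J)
  show ?case
    using insert sign_avg_insert_chaos[OF insert.hyps(1,2), of "\<lambda>x y. x" v "\<lambda>_. 0"] by simp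
qed simp

lemma sign_avg_rad_chaos_sq_insert:
  fixes v :: "'i \<Rightarrow> 'v::real_inner"
  assumes "finite J" "i \<notin> J"
  shows "sign_avg (insert i J) (\<lambda>s. (rad_chaos (insert i J) v s)\<^sup>2) =
    sign_avg J (\<lambda>s. (rad_chaos J v s)\<^sup>2) + sign_avg J (\<lambda>s. (rad_sum J (\<lambda>j. 2 * (v i \<bullet> v j)) s)\<^sup>2)"
proof -
  have *: "((z - m)\<^sup>2 + (z + m)\<^sup>2) / 2 = z\<^sup>2 + m\<^sup>2" for z m :: real
    by (simp add: power2_eq_square algebra_simps)
  show ?thesis
    unfolding sign_avg_insert_chaos[OF assms, of "\<lambda>x y. x\<^sup>2" v "\<lambda>_. 0"] * by simp
qed

text \<open>Since the chaos has mean zero, the product of the linear forms may be centred before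
  Cauchy-Schwarz is applied. Its variance is at most twice the product of the second moments,
  whereas the uncentred second moment would only give the factor 3.\<close>

lemma sign_avg_chaos_mult_rad_sums_sq_le:
  fixes l m :: "'i \<Rightarrow> real" and v :: "'i \<Rightarrow> 'v::real_inner"
  assumes "finite J"
  shows "(sign_avg J (\<lambda>s. rad_chaos J v s * (rad_sum J m s * rad_sum J l s)))\<^sup>2 \<le>
    2 * sign_avg J (\<lambda>s. (rad_chaos J v s)\<^sup>2) *
      (sign_avg J (\<lambda>s. (rad_sum J m s)\<^sup>2) * sign_avg J (\<lambda>s. (rad_sum J l s)\<^sup>2))"
proof -
  let ?Z = "rad_chaos J v" and ?L = "rad_sum J l" and ?M = "rad_sum J m"
  define e where "e = sign_avg J (\<lambda>s. ?M s * ?L s)"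
  have "sign_avg J (\<lambda>s. ?Z s * (?M s * ?L s)) = sign_avg J (\<lambda>s. ?Z s * (?M s * ?L s) - e * ?Z s)"
    using sign_avg_rad_chaos[OF assms, of v] by simp
  also have "\<dots> = sign_avg J (\<lambda>s. ?Z s * (?M s * ?L s - e))"
    by (simp only: right_diff_distrib mult.commute)
  finally have "(sign_avg J (\<lambda>s. ?Z s * (?M s * ?L s)))\<^sup>2 \<le>
      sign_avg J (\<lambda>s. (?Z s)\<^sup>2) * sign_avg J (\<lambda>s. (?M s * ?L s - e)\<^sup>2)"
    using sign_avg_Cauchy_Schwarz by simp
  also have "\<dots> \<le> sign_avg J (\<lambda>s. (?Z s)\<^sup>2) *
      (2 * (sign_avg J (\<lambda>s. (?M s)\<^sup>2) * sign_avg J (\<lambda>s. (?L s)\<^sup>2)))"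
  proof (rule mult_left_mono)
    have "sign_avg J (\<lambda>s. (?M s * ?L s - e)\<^sup>2) =
        sign_avg J (\<lambda>s. (?M s)\<^sup>2 * (?L s)\<^sup>2 - 2 * e * (?M s * ?L s) + e\<^sup>2)"
      by (simp only: power2_diff power_mult_distrib mult_ac)
        (rule sign_avg_cong, simp add: algebra_simps)
    also have "\<dots> = sign_avg J (\<lambda>s. (?M s)\<^sup>2 * (?L s)\<^sup>2) - e\<^sup>2"
      using assms by (simp add: power2_eq_square flip: e_def)
    also have "\<dots> \<le> sign_avg J (\<lambda>s. (?M s)\<^sup>2) * sign_avg J (\<lambda>s. (?L s)\<^sup>2) + e\<^sup>2"
      using sign_avg_rad_sums_sq_mult_sq_le[OF assms, of m l] by (simp add: e_def)
    also have "e\<^sup>2 \<le> sign_avg J (\<lambda>s. (?M s)\<^sup>2) * sign_avg J (\<lambda>s. (?L s)\<^sup>2)"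
      unfolding e_def by (rule sign_avg_Cauchy_Schwarz)
    finally show "sign_avg J (\<lambda>s. (?M s * ?L s - e)\<^sup>2) \<le>
        2 * (sign_avg J (\<lambda>s. (?M s)\<^sup>2) * sign_avg J (\<lambda>s. (?L s)\<^sup>2))"
      by linarith
  qed (simp add: sign_avg_nonneg)
  finally show ?thesis by simp
qed

text \<open>A new sign turns \<open>Z\<close> and \<open>L\<close> into
  \<open>Z \<plusminus> M\<close> and \<open>L \<plusminus> c\<close>. The constant 5 closes the
  induction exactly: the coefficient of \<open>c\<^sup>2 * ZZ\<close> becomes 1 + 4 and that of
  \<open>MM * LL\<close> becomes 3 + 2, where 4 and 2 come from the cross term.\<close>

lemma sign_avg_chaos_sq_mult_rad_sum_sq_le:
  fixes l :: "'i \<Rightarrow> real" and v :: "'i \<Rightarrow> 'v::real_inner"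
  assumes "finite J"
  shows "sign_avg J (\<lambda>s. (rad_chaos J v s)\<^sup>2 * (rad_sum J l s)\<^sup>2) \<le>
    5 * (sign_avg J (\<lambda>s. (rad_chaos J v s)\<^sup>2) * sign_avg J (\<lambda>s. (rad_sum J l s)\<^sup>2))"
  using assms
proof (induction J rule: finite_induct)
  case empty
  then show ?case by simp
next
  case (insert i J)
  define m where "m = (\<lambda>j. 2 * (v i \<bullet> v j))"
  define c where "c = l i"
  let ?Z = "rad_chaos J v" and ?L = "rad_sum J l" and ?M = "rad_sum J m"
  define ZZ where "ZZ = sign_avg J (\<lambda>s. (?Z s)\<^sup>2)"
  define LL where "LL = sign_avg J (\<lambda>s. (?L s)\<^sup>2)"
  define MM where "MM = sign_avg J (\<lambda>s. (?M s)\<^sup>2)"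
  define T where "T = sign_avg J (\<lambda>s. ?Z s * (?M s * ?L s))"
  have nn: "ZZ \<ge> 0" "LL \<ge> 0" "MM \<ge> 0"
    by (auto simp: ZZ_def LL_def MM_def intro: sign_avg_nonneg)
  have *: "((z - m)\<^sup>2 * (x - c)\<^sup>2 + (z + m)\<^sup>2 * (x + c)\<^sup>2) / 2 =
      z\<^sup>2 * x\<^sup>2 + c\<^sup>2 * z\<^sup>2 + m\<^sup>2 * x\<^sup>2 + c\<^sup>2 * m\<^sup>2 + 4 * c * (z * (m * x))" for z m x :: real
    by (simp add: power2_eq_square algebra_simps)
  \<comment> \<open>the only term of unclear sign; AM-GM absorbs it into the slack that the constant 5 leaves\<close>
  have "(4 * c * T)\<^sup>2 \<le> (4 * c\<^sup>2 * ZZ + 2 * (MM * LL))\<^sup>2"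
  proof -
    have "(4 * c * T)\<^sup>2 = 16 * c\<^sup>2 * T\<^sup>2"
      by (simp add: power_mult_distrib)
    also have "\<dots> \<le> 16 * c\<^sup>2 * (2 * ZZ * (MM * LL))"
      using sign_avg_chaos_mult_rad_sums_sq_le[OF insert.hyps(1), of v m l]
      unfolding T_def ZZ_def MM_def LL_def by (intro mult_left_mono) auto
    also have "\<dots> \<le> (4 * c\<^sup>2 * ZZ + 2 * (MM * LL))\<^sup>2"
      using zero_le_power2[of "4 * c\<^sup>2 * ZZ - 2 * (MM * LL)"]
      by (simp add: power2_eq_square algebra_simps)
    finally show ?thesis .
  qed
  moreover have "0 \<le> 4 * c\<^sup>2 * ZZ + 2 * (MM * LL)"
    using nn by simp
  ultimately have T: "4 * c * T \<le> 4 * c\<^sup>2 * ZZ + 2 * (MM * LL)"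
    by (rule power2_le_imp_le)
  have "(sign_avg J (\<lambda>s. ?M s * ?L s))\<^sup>2 \<le> MM * LL"
    unfolding MM_def LL_def by (rule sign_avg_Cauchy_Schwarz)
  moreover have "sign_avg J (\<lambda>s. (?M s)\<^sup>2 * (?L s)\<^sup>2) \<le>
      MM * LL + 2 * (sign_avg J (\<lambda>s. ?M s * ?L s))\<^sup>2"
    unfolding MM_def LL_def by (rule sign_avg_rad_sums_sq_mult_sq_le[OF insert.hyps(1)])
  ultimately have ML4: "sign_avg J (\<lambda>s. (?M s)\<^sup>2 * (?L s)\<^sup>2) \<le> 3 * (MM * LL)"
    by linarith
  have "sign_avg (insert i J) (\<lambda>s. (rad_chaos (insert i J) v s)\<^sup>2 * (rad_sum (insert i J) l s)\<^sup>2) =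
      sign_avg J (\<lambda>s. (?Z s)\<^sup>2 * (?L s)\<^sup>2) + c\<^sup>2 * ZZ
      + sign_avg J (\<lambda>s. (?M s)\<^sup>2 * (?L s)\<^sup>2) + c\<^sup>2 * MM + 4 * c * T"
    unfolding sign_avg_insert_chaos[OF insert.hyps(1,2), of "\<lambda>x y. x\<^sup>2 * y\<^sup>2"]
      m_def[symmetric] c_def[symmetric] *
    by (simp add: ZZ_def MM_def T_def)
  also have "\<dots> \<le> 5 * (ZZ * LL) + c\<^sup>2 * ZZ + 3 * (MM * LL) + c\<^sup>2 * MM
      + (4 * c\<^sup>2 * ZZ + 2 * (MM * LL))"
    using insert.IH T ML4 unfolding ZZ_def[symmetric] LL_def[symmetric] by linarith
  also have "\<dots> \<le> 5 * ((ZZ + MM) * (LL + c\<^sup>2))"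
    using nn by (simp add: algebra_simps)
  finally show ?case
    using insert.hyps
    by (simp add: sign_avg_rad_chaos_sq_insert sign_avg_rad_sum_sq_insert
        ZZ_def MM_def LL_def m_def c_def)
qed

text \<open>Averaging over the new sign kills the odd powers of \<open>M\<close>. The mixed term
  contributes at most 6 * 5 = 30 times \<open>ZZ * MM\<close>, which is the cross term of
  \<open>15 * (ZZ + MM)\<^sup>2\<close>; this fixes the constant 15.\<close>

lemma sign_avg_rad_chaos_power4_le:
  fixes v :: "'i \<Rightarrow> 'v::real_inner"
  assumes "finite J"
  shows "sign_avg J (\<lambda>s. rad_chaos J v s ^ 4) \<le> 15 * (sign_avg J (\<lambda>s. (rad_chaos J v s)\<^sup>2))\<^sup>2"
  using assms
proof (induction J rule: finite_induct)
  case empty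
  then show ?case by simp
next
  case (insert i J)
  define m where "m = (\<lambda>j. 2 * (v i \<bullet> v j))"
  let ?Z = "rad_chaos J v" and ?M = "rad_sum J m"
  define ZZ where "ZZ = sign_avg J (\<lambda>s. (?Z s)\<^sup>2)"
  define MM where "MM = sign_avg J (\<lambda>s. (?M s)\<^sup>2)"
  have nn: "ZZ \<ge> 0" "MM \<ge> 0"
    by (auto simp: ZZ_def MM_def intro: sign_avg_nonneg)
  have *: "((z - m) ^ 4 + (z + m) ^ 4) / 2 = z ^ 4 + 6 * (z\<^sup>2 * m\<^sup>2) + m\<^sup>2 * m\<^sup>2" for z m :: real
    by (simp add: power2_eq_square power4_eq_xxxx algebra_simps)
  have MMM: "sign_avg J (\<lambda>s. (?M s)\<^sup>2 * (?M s)\<^sup>2) \<le> 3 * MM\<^sup>2"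
    using sign_avg_rad_sums_sq_mult_sq_le[OF insert.hyps(1), of m m]
    by (simp add: MM_def power2_eq_square)
  have "sign_avg (insert i J) (\<lambda>s. rad_chaos (insert i J) v s ^ 4) =
      sign_avg J (\<lambda>s. ?Z s ^ 4) + 6 * sign_avg J (\<lambda>s. (?Z s)\<^sup>2 * (?M s)\<^sup>2)
      + sign_avg J (\<lambda>s. (?M s)\<^sup>2 * (?M s)\<^sup>2)"
    unfolding sign_avg_insert_chaos[OF insert.hyps(1,2), of "\<lambda>x y. x ^ 4" v "\<lambda>_. 0"]
      m_def[symmetric] *
    by simp
  also have "\<dots> \<le> 15 * ZZ\<^sup>2 + 6 * (5 * (ZZ * MM)) + 3 * MM\<^sup>2"
    using insert.IH MMM sign_avg_chaos_sq_mult_rad_sum_sq_le[OF insert.hyps(1), of v m]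
    unfolding ZZ_def[symmetric] MM_def[symmetric] by linarith
  also have "\<dots> \<le> 15 * (ZZ + MM)\<^sup>2"
    using nn by (simp add: power2_eq_square algebra_simps)
  finally show ?case
    using insert.hyps by (simp add: sign_avg_rad_chaos_sq_insert ZZ_def MM_def m_def)
qed

lemma integral_pmf_of_set_Pow:
  "finite J \<Longrightarrow> measure_pmf.expectation (pmf_of_set (Pow J)) f = sign_avg J f"
  by (simp add: sign_avg_def integral_pmf_of_set card_Pow Pow_not_empty)

text \<open>The fourth-moment bound with constant 15, under the uniform distribution on
  \<open>Pow J\<close>. The form as a count allows its use separately at each sample point, where
  the vectors are fixed.\<close>

lemma card_rad_chaos_nonneg_ge:
  fixes v :: "'i \<Rightarrow> 'v::real_inner"
  assumes J: "finite J"
  shows "real (card {s \<in> Pow J. rad_chaos J v s \<ge> 0}) \<ge> (2 * sqrt 3 - 3) / 15 * 2 ^ card J"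
proof -
  let ?p = "pmf_of_set (Pow J)"
  have fin: "finite (set_pmf ?p)"
    using J by (simp add: set_pmf_of_set Pow_not_empty)
  have "(2 * sqrt 3 - 3) / 15 \<le> measure_pmf.prob ?p {s \<in> space ?p. rad_chaos J v s \<ge> 0}"
    using sign_avg_rad_chaos[OF J, of v] sign_avg_rad_chaos_power4_le[OF J, of v]
    by (intro measure_pmf.prob_nonneg_ge_fourth_moment)
       (auto simp: integral_pmf_of_set_Pow J fin integrable_measure_pmf_finite)
  also have "\<dots> = card {s \<in> Pow J. rad_chaos J v s \<ge> 0} / 2 ^ card J"
    using J by (simp add: measure_pmf_of_set Pow_not_empty card_Pow Int_def)
  finally show ?thesis
    by (simp add: field_simps)
qed

section \<open>Moments of quadratic forms on the sphere\<close>

lemma AE_norm_uniform_sphere: "AE x in (uniform_sphere :: (real^'d) measure). norm x = 1"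
  using AE_uniform_sphere[where 'd='d] by simp

lemma integrable_uniform_sphere:
  fixes f :: "real^'d \<Rightarrow> real"
  assumes "continuous_on UNIV f"
  shows "integrable uniform_sphere f"
proof -
  interpret U: prob_space "uniform_sphere :: (real^'d) measure"
    by (rule prob_space_uniform_sphere)
  have "compact (f ` sphere 0 1)"
    using assms by (intro compact_continuous_image continuous_on_subset[OF assms]) auto
  then obtain B where B: "\<And>x. x \<in> sphere 0 1 \<Longrightarrow> \<bar>f x\<bar> \<le> B"
    by (meson bounded_real compact_imp_bounded imageI)
  have "f \<in> borel_measurable uniform_sphere"
    using borel_measurable_continuous_onI[OF assms] by simp
  moreover have "AE x in uniform_sphere. norm (f x) \<le> B"
    using AE_uniform_sphere by eventually_elim (use B in auto)
  ultimately show ?thesis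
    by (rule U.integrable_const_bound[rotated])
qed

text \<open>Rotation invariance makes the integral of \<open>F (T \<theta> x)\<close> independent of
  the angle, where \<open>T \<theta>\<close> rotates the plane of \<open>b\<close> and
  \<open>c\<close> and \<open>K\<close> generates this rotation. The identity is the derivative at
  angle 0, taken under the integral.\<close>

lemma integral_uniform_sphere_infinitesimal_rotation:
  fixes F :: "real^'d \<Rightarrow> real" and b c :: "real^'d"
  defines "K \<equiv> \<lambda>x. (x \<bullet> b) *\<^sub>R c - (x \<bullet> c) *\<^sub>R b"
  assumes b: "b \<in> Basis" and c: "c \<in> Basis"
    and F: "\<And>x. (F has_derivative F' x) (at x)"
    and cont: "continuous_on UNIV (\<lambda>x. F' x (K x))"
  shows "(\<integral>x. F' x (K x) \<partial>uniform_sphere) = 0"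
proof (cases "b = c")
  case True
  have "F' x 0 = 0" for x
    using F[of x] by (meson has_derivative_bounded_linear linear_simps(3))
  then show ?thesis
    using True by (simp add: K_def)
next
  case False
  interpret U: prob_space "uniform_sphere :: (real^'d) measure"
    by (rule prob_space_uniform_sphere)
  have bc: "b \<bullet> b = 1" "c \<bullet> c = 1" "b \<bullet> c = 0" "c \<bullet> b = 0"
    using b c False by (auto simp: inner_Basis)
  \<comment> \<open>Written as the identity plus a correction in the plane of \<open>b\<close> and
    \<open>c\<close>, so that the orthogonal complement is visibly fixed.\<close>
  define T where "T = (\<lambda>\<theta> x. x + ((cos \<theta> - 1) * (x \<bullet> b) - sin \<theta> * (x \<bullet> c)) *\<^sub>R b
      + ((cos \<theta> - 1) * (x \<bullet> c) + sin \<theta> * (x \<bullet> b)) *\<^sub>R c)"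
  have T0: "T 0 x = x" for x
    by (simp add: T_def)
  have Tb: "T \<theta> x \<bullet> b = cos \<theta> * (x \<bullet> b) - sin \<theta> * (x \<bullet> c)"
    and Tc: "T \<theta> x \<bullet> c = cos \<theta> * (x \<bullet> c) + sin \<theta> * (x \<bullet> b)" for \<theta> x
    by (simp_all add: T_def inner_add_left bc algebra_simps)
  have orth: "orthogonal_transformation (T \<theta>)" for \<theta>
  proof -
    have "linear (T \<theta>)"
      by (rule linearI) (simp_all add: T_def inner_add_left algebra_simps)
    moreover have "T \<theta> x \<bullet> T \<theta> y = x \<bullet> y" for x y
    proof -
      have "T \<theta> x \<bullet> T \<theta> y = T \<theta> x \<bullet> y + ((cos \<theta> - 1) * (y \<bullet> b) - sin \<theta> * (y \<bullet> c)) * (T \<theta> x \<bullet> b)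
          + ((cos \<theta> - 1) * (y \<bullet> c) + sin \<theta> * (y \<bullet> b)) * (T \<theta> x \<bullet> c)"
        by (subst (2) T_def) (simp add: inner_add_right)
      also have "T \<theta> x \<bullet> y = x \<bullet> y + ((cos \<theta> - 1) * (x \<bullet> b) - sin \<theta> * (x \<bullet> c)) * (y \<bullet> b)
          + ((cos \<theta> - 1) * (x \<bullet> c) + sin \<theta> * (x \<bullet> b)) * (y \<bullet> c)"
        by (simp add: T_def inner_add_left inner_commute[of y])
      finally show ?thesis
        unfolding Tb Tc using sin_cos_squared_add[of \<theta>] by algebra
    qed
    ultimately show ?thesis
      by (simp add: orthogonal_transformation_def)
  qed
  have norm_T: "norm (T \<theta> x) = norm x" for \<theta> x
    using orth by (rule orthogonal_transformation_norm)
  have dT: "((\<lambda>\<theta>. F (T \<theta> x)) has_real_derivative F' (T \<theta> x) (K (T \<theta> x))) (at \<theta>)" for \<theta> x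
  proof -
    have "((\<lambda>\<theta>. T \<theta> x) has_vector_derivative K (T \<theta> x)) (at \<theta>)"
      unfolding K_def Tb Tc unfolding T_def
      by (auto intro!: derivative_eq_intros simp: has_vector_derivative_def algebra_simps)
    then have "((\<lambda>\<theta>. F (T \<theta> x)) has_derivative (\<lambda>h. F' (T \<theta> x) (h *\<^sub>R K (T \<theta> x)))) (at \<theta>)"
      unfolding has_vector_derivative_def by (rule has_derivative_compose[OF _ F])
    moreover have "F' (T \<theta> x) (h *\<^sub>R y) = F' (T \<theta> x) y * h" for h y
      using F[of "T \<theta> x"] has_derivative_bounded_linear linear_simps(5) by (fastforce simp: mult.commute)
    ultimately show ?thesis
      by (simp add: has_field_derivative_def)
  qed
  have contF: "continuous_on UNIV F"
    using F by (meson continuous_at_imp_continuous_on has_derivative_continuous)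
  then have [measurable]: "F \<in> borel_measurable borel"
    by (rule borel_measurable_continuous_onI)
  have [measurable]: "T \<theta> \<in> borel_measurable borel" for \<theta>
    using orth by (rule borel_measurable_orthogonal_transformation)
  have intT: "integrable uniform_sphere (\<lambda>x. F (T \<theta> x))" for \<theta>
    using linear_continuous_on[of "T \<theta>" UNIV] orthogonal_transformation_linear[OF orth, of \<theta>]
    by (intro integrable_uniform_sphere continuous_on_compose2[OF contF])
       (auto simp: linear_conv_bounded_linear)
  have ET: "(\<integral>x. F (T \<theta> x) \<partial>uniform_sphere) = (\<integral>x. F x \<partial>uniform_sphere)" for \<theta>
  proof -
    have "(\<integral>x. F x \<partial>uniform_sphere) = (\<integral>x. F x \<partial>distr uniform_sphere borel (T \<theta>))"
      by (simp only: uniform_sphere_rotation_invariant[OF orth])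
    also have "\<dots> = (\<integral>x. F (T \<theta> x) \<partial>uniform_sphere)"
      by (subst integral_distr) auto
    finally show ?thesis ..
  qed
  have "compact ((\<lambda>x. F' x (K x)) ` sphere 0 1)"
    by (intro compact_continuous_image continuous_on_subset[OF cont]) auto
  then obtain B where B: "\<And>x. x \<in> sphere 0 1 \<Longrightarrow> \<bar>F' x (K x)\<bar> \<le> B"
    by (meson bounded_real compact_imp_bounded imageI)
  let ?h = "\<lambda>n. inverse (real (Suc n))"
  let ?s = "\<lambda>n x. (F (T (?h n) x) - F x) / ?h n"
  have h: "filterlim ?h (at 0) sequentially"
    by (intro filterlim_atI LIMSEQ_inverse_real_of_nat) auto
  have "(\<lambda>n. \<integral>x. ?s n x \<partial>uniform_sphere) \<longlonglongrightarrow> (\<integral>x. F' x (K x) \<partial>uniform_sphere)"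
  proof (rule integral_dominated_convergence)
    show "AE x in uniform_sphere. (\<lambda>n. ?s n x) \<longlonglongrightarrow> F' x (K x)"
    proof (rule AE_I2)
      fix x
      have "((\<lambda>h. (F (T (0 + h) x) - F (T 0 x)) / h) \<longlongrightarrow> F' (T 0 x) (K (T 0 x))) (at 0)"
        using dT[of x 0] by (rule DERIV_D)
      then show "(\<lambda>n. ?s n x) \<longlonglongrightarrow> F' x (K x)"
        using filterlim_compose[OF _ h] by (fastforce simp: T0)
    qed
    show "AE x in uniform_sphere. norm (?s n x) \<le> B" for n
      using AE_norm_uniform_sphere
    proof eventually_elim
      case (elim x)
      \<comment> \<open>By the mean value theorem the difference quotient is a derivative at the
        rotated point \<open>T z x\<close>, again of norm 1, so one constant \<open>B\<close>
        dominates for all \<open>n\<close>.\<close>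
      have "\<exists>z>0. z < ?h n \<and> F (T (?h n) x) - F (T 0 x) = (?h n - 0) * F' (T z x) (K (T z x))"
        by (rule MVT2) (use dT in auto)
      then obtain z where "?s n x = F' (T z x) (K (T z x))"
        by (auto simp: T0)
      then show ?case
        using B[of "T z x"] elim by (simp add: norm_T)
    qed
    show "(\<lambda>x. F' x (K x)) \<in> borel_measurable uniform_sphere"
      using borel_measurable_continuous_onI[OF cont] by simp
  qed auto
  moreover have "(\<integral>x. ?s n x \<partial>uniform_sphere) = 0" for n
    using ET[of "?h n"] intT[of "?h n"] intT[of 0] by (simp add: T0 del: inverse_Suc of_nat_Suc)
  ultimately show ?thesis
    by (simp add: LIMSEQ_const_iff)
qed

section \<open>Trace and integration by parts on the sphere\<close>

definition op_trace :: "(real^'d \<Rightarrow> real^'d) \<Rightarrow> real" where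
  "op_trace f = (\<Sum>b\<in>Basis. f b \<bullet> b)"

text \<open>
  This is Stein's identity for the vector field \<open>V x = F x *\<^sub>R f x\<close>: the infinitesimal rotation
  identity is applied to \<open>(x \<bullet> c) * (V x \<bullet> b)\<close> in the plane of \<open>b\<close> and \<open>c\<close>, and summed over all basis
  vectors \<open>b\<close> and \<open>c\<close>.
\<close>

lemma integral_uniform_sphere_by_parts:
  fixes F :: "real^'d \<Rightarrow> real" and f :: "real^'d \<Rightarrow> real^'d"
  assumes f: "bounded_linear f"
    and F: "\<And>x. (F has_derivative F' x) (at x)"
    and cont: "\<And>g. bounded_linear g \<Longrightarrow> continuous_on UNIV (\<lambda>x. F' x (g x))"
  shows "(\<integral>x. F' x (f x) + op_trace f * F x \<partial>uniform_sphere) =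
    (\<integral>x. CARD('d) * (F x * (x \<bullet> f x)) + F' x x * (x \<bullet> f x) \<partial>uniform_sphere)"
proof -
  have contF: "continuous_on UNIV F"
    using F by (meson continuous_at_imp_continuous_on has_derivative_continuous)
  note [continuous_intros] = linear_continuous_on[OF f] contF cont[OF bounded_linear_ident] cont[OF f]
  have linF: "linear (F' x)" for x
    using F[of x] by (simp add: has_derivative_linear)
  have linf: "linear f"
    using f by (simp add: linear_conv_bounded_linear)
  define G where "G = (\<lambda>b c x. (x \<bullet> c) * (F x * (f x \<bullet> b)))"
  define G' where "G' = (\<lambda>b c x h. (h \<bullet> c) * (F x * (f x \<bullet> b)) +
      (x \<bullet> c) * (F' x h * (f x \<bullet> b) + F x * (f h \<bullet> b)))"
  have G: "(G b c has_derivative G' b c x) (at x)" for b c x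
    unfolding G_def G'_def
    by (auto intro!: derivative_eq_intros F bounded_linear.has_derivative[OF f] simp: algebra_simps)
  \<comment> \<open>The generator of the previous lemma with \<open>b\<close> and \<open>c\<close>
    exchanged.\<close>
  define K where "K = (\<lambda>b c (x::real^'d). (x \<bullet> c) *\<^sub>R b - (x \<bullet> b) *\<^sub>R c)"
  have blK: "bounded_linear (K b c)" for b c
    unfolding K_def
    by (intro bounded_linear_sub bounded_linear_scaleR_const bounded_linear_inner_left)
  have contG: "continuous_on UNIV (\<lambda>x. G' b c x (K b c x))" for b c
    unfolding G'_def
    by (intro continuous_intros cont[OF blK] linear_continuous_on[OF blK]
        continuous_on_compose2[OF linear_continuous_on[OF f] linear_continuous_on[OF blK]]) auto
  have "0 = (\<Sum>b\<in>Basis. \<Sum>c\<in>Basis. \<integral>x. G' b c x (K b c x) \<partial>uniform_sphere)"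
    using integral_uniform_sphere_infinitesimal_rotation[OF _ _ G contG[unfolded K_def]]
    by (simp add: K_def)
  also have "\<dots> = (\<integral>x. (\<Sum>b\<in>Basis. \<Sum>c\<in>Basis. G' b c x (K b c x)) \<partial>uniform_sphere)"
    using integrable_uniform_sphere[OF contG] by (simp add: Bochner_Integration.integral_sum)
  also have "\<dots> = (\<integral>x. (F' x (f x) + op_trace f * F x) -
      (CARD('d) * (F x * (x \<bullet> f x)) + F' x x * (x \<bullet> f x)) \<partial>uniform_sphere)"
  \<comment> \<open>The integrands agree only for \<open>norm x = 1\<close>, because the sum of the
    squared coordinates is replaced by 1.\<close>
  proof (rule integral_cong_AE)
    show "AE x in uniform_sphere. (\<Sum>b\<in>Basis. \<Sum>c\<in>Basis. G' b c x (K b c x)) =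
      (F' x (f x) + op_trace f * F x) - (CARD('d) * (F x * (x \<bullet> f x)) + F' x x * (x \<bullet> f x))"
      using AE_norm_uniform_sphere
    proof eventually_elim
      case (elim x)
      have xx: "(\<Sum>c\<in>Basis. (x \<bullet> c) * (x \<bullet> c)) = 1"
        using elim by (simp add: norm_eq_sqrt_inner flip: euclidean_inner)
      have rep: "(\<Sum>c\<in>Basis. (x \<bullet> c) * g c) = g x" if "linear g" for g :: "real^'d \<Rightarrow> real"
      proof -
        have "g (\<Sum>c\<in>Basis. (x \<bullet> c) *\<^sub>R c) = (\<Sum>c\<in>Basis. (x \<bullet> c) * g c)"
          using that by (simp add: linear_sum linear_scale)
        then show ?thesis by (simp add: euclidean_representation)
      qed
      \<comment> \<open>The terms are grouped so that each sum over \<open>c\<close> is a constant,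
        a squared norm, or a sum of \<open>(x \<bullet> c) * g c\<close> with \<open>g\<close>
        linear, which collapses to \<open>g x\<close>.\<close>
      have G'K: "G' b c x (K b c x) =
          F x * ((x \<bullet> c) * ((b \<bullet> c) * (f x \<bullet> b))) - F x * ((x \<bullet> b) * (f x \<bullet> b)) * (c \<bullet> c)
          + ((x \<bullet> c) * (x \<bullet> c)) * (F' x b * (f x \<bullet> b) + F x * (f b \<bullet> b))
          - (x \<bullet> b) * ((x \<bullet> c) * (F' x c * (f x \<bullet> b) + F x * (f c \<bullet> b)))" for b c
        unfolding G'_def K_def
        by (simp add: linear_diff[OF linF] linear_diff[OF linf] linear_scale[OF linF]
            linear_scale[OF linf] inner_diff_left algebra_simps)
      have lin1: "linear (\<lambda>c. (b \<bullet> c) * (f x \<bullet> b))" for b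
        by (rule linearI) (auto simp: inner_add_right algebra_simps)
      have lin2: "linear (\<lambda>c. F' x c * (f x \<bullet> b) + F x * (f c \<bullet> b))" for b
        by (rule linearI) (auto simp: linear_add[OF linF] linear_add[OF linf] linear_scale[OF linF]
            linear_scale[OF linf] inner_add_left algebra_simps)
      have "(\<Sum>c\<in>Basis. G' b c x (K b c x)) =
          F x * ((b \<bullet> x) * (f x \<bullet> b)) - CARD('d) * (F x * ((x \<bullet> b) * (f x \<bullet> b)))
          + (F' x b * (f x \<bullet> b) + F x * (f b \<bullet> b))
          - (x \<bullet> b) * (F' x x * (f x \<bullet> b) + F x * (f x \<bullet> b))" for b
        unfolding G'K sum_subtractf sum.distrib
        by (simp add: rep[OF lin1] rep[OF lin2] xx flip: sum_distrib_left sum_distrib_right)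
      also have "\<dots> b = ((f x \<bullet> b) * F' x b + F x * (f b \<bullet> b))
          - (CARD('d) * F x + F' x x) * ((x \<bullet> b) * (f x \<bullet> b))" for b
        by (simp add: inner_commute algebra_simps)
      finally have "(\<Sum>b\<in>Basis. \<Sum>c\<in>Basis. G' b c x (K b c x)) =
          (\<Sum>b\<in>Basis. (f x \<bullet> b) * F' x b) + F x * op_trace f
          - (CARD('d) * F x + F' x x) * (\<Sum>b\<in>Basis. (x \<bullet> b) * (f x \<bullet> b))"
        by (simp add: sum.distrib sum_subtractf op_trace_def sum_distrib_left)
      also have "(\<Sum>b\<in>Basis. (f x \<bullet> b) * F' x b) = F' x (f x)"
      proof -
        have "F' x (\<Sum>b\<in>Basis. (f x \<bullet> b) *\<^sub>R b) = (\<Sum>b\<in>Basis. (f x \<bullet> b) * F' x b)"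
          by (simp add: linear_sum[OF linF] linear_scale[OF linF])
        then show ?thesis by (simp add: euclidean_representation)
      qed
      also have "(\<Sum>b\<in>Basis. (x \<bullet> b) * (f x \<bullet> b)) = x \<bullet> f x"
        by (simp flip: euclidean_inner)
      finally show ?case
        by (simp add: algebra_simps)
    qed
  next
    show "(\<lambda>x. \<Sum>b\<in>Basis. \<Sum>c\<in>Basis. G' b c x (K b c x)) \<in> borel_measurable uniform_sphere"
      using integrable_uniform_sphere[OF contG] by (intro borel_measurable_sum) auto
  next
    show "(\<lambda>x. (F' x (f x) + op_trace f * F x) -
        (CARD('d) * (F x * (x \<bullet> f x)) + F' x x * (x \<bullet> f x))) \<in> borel_measurable uniform_sphere"
      by (intro borel_measurable_integrable integrable_uniform_sphere continuous_intros)
  qed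
  also have "\<dots> = (\<integral>x. F' x (f x) + op_trace f * F x \<partial>uniform_sphere) -
      (\<integral>x. CARD('d) * (F x * (x \<bullet> f x)) + F' x x * (x \<bullet> f x) \<partial>uniform_sphere)"
    by (intro Bochner_Integration.integral_diff integrable_uniform_sphere continuous_intros)
  finally show ?thesis by simp
qed

text \<open>Integration by parts with \<open>F\<close> the product of the three forms.
  Self-adjointness makes twice \<open>S x\<close> the gradient of \<open>x \<bullet> S x\<close>,
  and Euler's identity for the degree 6 polynomial \<open>F\<close> gives
  \<open>F' x x = 6 * F x\<close>, hence the factor \<open>CARD('d) + 6\<close>.\<close>

lemma integral_uniform_sphere_quad_forms:
  fixes f S T U :: "real^'d \<Rightarrow> real^'d"
  assumes f: "bounded_linear f" and S: "bounded_linear S" and T: "bounded_linear T" and U: "bounded_linear U"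
    and adj: "\<And>x y. x \<bullet> S y = S x \<bullet> y" "\<And>x y. x \<bullet> T y = T x \<bullet> y" "\<And>x y. x \<bullet> U y = U x \<bullet> y"
  shows "(real CARD('d) + 6) * (\<integral>x. (x \<bullet> f x) * ((x \<bullet> S x) * (x \<bullet> T x) * (x \<bullet> U x)) \<partial>uniform_sphere) =
    op_trace f * (\<integral>x. (x \<bullet> S x) * (x \<bullet> T x) * (x \<bullet> U x) \<partial>uniform_sphere) +
    2 * (\<integral>x. (S x \<bullet> f x) * (x \<bullet> T x) * (x \<bullet> U x) + (x \<bullet> S x) * (T x \<bullet> f x) * (x \<bullet> U x) +
      (x \<bullet> S x) * (x \<bullet> T x) * (U x \<bullet> f x) \<partial>uniform_sphere)"
proof -
  note blin = f S T U
  note [continuous_intros] = blin[THEN linear_continuous_on]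
  define F where "F = (\<lambda>x. (x \<bullet> S x) * (x \<bullet> T x) * (x \<bullet> U x))"
  define F' where "F' = (\<lambda>x h. 2 * ((S x \<bullet> h) * (x \<bullet> T x) * (x \<bullet> U x) +
      (x \<bullet> S x) * (T x \<bullet> h) * (x \<bullet> U x) + (x \<bullet> S x) * (x \<bullet> T x) * (U x \<bullet> h)))"
  have quad: "((\<lambda>x. x \<bullet> g x) has_derivative (\<lambda>h. 2 * (g x \<bullet> h))) (at x)"
    if g: "bounded_linear g" and g_adj: "\<And>x y. x \<bullet> g y = g x \<bullet> y" for g :: "real^'d \<Rightarrow> real^'d" and x
  proof -
    have "h \<bullet> g x + x \<bullet> g h = 2 * (g x \<bullet> h)" for h
      using g_adj[of x h] inner_commute[of h "g x"] by simp
    then show ?thesis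
      by (auto intro!: derivative_eq_intros bounded_linear.has_derivative[OF g] simp: add.commute)
  qed
  have F: "(F has_derivative F' x) (at x)" for x
    unfolding F_def F'_def
    by (rule derivative_eq_intros quad S T U adj refl)+ (simp add: fun_eq_iff algebra_simps)
  have "(\<integral>x. F' x (f x) + op_trace f * F x \<partial>uniform_sphere) =
      (\<integral>x. CARD('d) * (F x * (x \<bullet> f x)) + F' x x * (x \<bullet> f x) \<partial>uniform_sphere)"
  proof (rule integral_uniform_sphere_by_parts[OF f F])
    fix g :: "real^'d \<Rightarrow> real^'d"
    assume "bounded_linear g"
    note [continuous_intros] = linear_continuous_on[OF this]
    show "continuous_on UNIV (\<lambda>x. F' x (g x))"
      unfolding F'_def by (intro continuous_intros)
  qed
  also have "(\<lambda>x. CARD('d) * (F x * (x \<bullet> f x)) + F' x x * (x \<bullet> f x)) =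
      (\<lambda>x. (real CARD('d) + 6) * ((x \<bullet> f x) * F x))"
    by (simp add: F_def F'_def fun_eq_iff inner_commute[of "S _"] inner_commute[of "T _"]
        inner_commute[of "U _"] algebra_simps)
  finally have "(real CARD('d) + 6) * (\<integral>x. (x \<bullet> f x) * F x \<partial>uniform_sphere) =
      (\<integral>x. F' x (f x) + op_trace f * F x \<partial>uniform_sphere)"
    by simp
  also have "\<dots> = (\<integral>x. F' x (f x) \<partial>uniform_sphere) + (\<integral>x. op_trace f * F x \<partial>uniform_sphere)"
    unfolding F_def F'_def
    by (intro Bochner_Integration.integral_add integrable_uniform_sphere continuous_intros)
  finally show ?thesis
    by (simp add: F_def F'_def del: distrib_left_numeral)
qed

text \<open>The trace of the square of a self-adjoint operator is its squared Hilbert-Schmidt norm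
  and dominates the squared operator norm. The resulting bound on \<open>f y \<bullet> f y\<close>
  is applied at \<open>y = f b\<close>.\<close>

lemma op_trace_square_of_square_le:
  fixes f :: "real^'d \<Rightarrow> real^'d"
  assumes adj: "\<And>x y. x \<bullet> f y = f x \<bullet> y"
  shows "op_trace (f \<circ> f \<circ> (f \<circ> f)) \<le> (op_trace (f \<circ> f))\<^sup>2"
proof -
  have tr: "op_trace (f \<circ> f) = (\<Sum>b\<in>Basis. f b \<bullet> f b)"
    by (simp add: op_trace_def adj)
  have le: "f y \<bullet> f y \<le> (y \<bullet> y) * op_trace (f \<circ> f)" for y
  proof -
    have "f y \<bullet> f y = (\<Sum>b\<in>Basis. (f y \<bullet> b)\<^sup>2)"
      using euclidean_inner[of "f y" "f y"] by (simp add: power2_eq_square)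
    also have "\<dots> \<le> (\<Sum>b\<in>Basis. (y \<bullet> y) * (f b \<bullet> f b))"
    proof (rule sum_mono)
      fix b
      show "(f y \<bullet> b)\<^sup>2 \<le> (y \<bullet> y) * (f b \<bullet> f b)"
        using Cauchy_Schwarz_ineq[of y "f b"] by (simp add: adj)
    qed
    also have "\<dots> = (y \<bullet> y) * op_trace (f \<circ> f)"
      by (simp add: tr sum_distrib_left)
    finally show ?thesis .
  qed
  have "op_trace (f \<circ> f \<circ> (f \<circ> f)) = (\<Sum>b\<in>Basis. f (f b) \<bullet> f (f b))"
    by (simp add: op_trace_def adj)
  also have "\<dots> \<le> (\<Sum>b\<in>Basis. (f b \<bullet> f b) * op_trace (f \<circ> f))"
    by (intro sum_mono le)
  also have "\<dots> = (op_trace (f \<circ> f))\<^sup>2"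
    by (simp add: tr power2_eq_square sum_distrib_right)
  finally show ?thesis .
qed

text \<open>Integration by parts with the constant function 1.\<close>

lemma integral_uniform_sphere_quad_form:
  fixes f :: "real^'d \<Rightarrow> real^'d"
  assumes f: "bounded_linear f"
  shows "(\<integral>x. x \<bullet> f x \<partial>uniform_sphere) = op_trace f / CARD('d)"
proof -
  interpret U: prob_space "uniform_sphere :: (real^'d) measure"
    by (rule prob_space_uniform_sphere)
  note [continuous_intros] = linear_continuous_on[OF f]
  have "(\<integral>x. 0 + op_trace f * 1 \<partial>(uniform_sphere :: (real^'d) measure)) =
      (\<integral>x. CARD('d) * (1 * (x \<bullet> f x)) + 0 * (x \<bullet> f x) \<partial>uniform_sphere)"
    by (rule integral_uniform_sphere_by_parts[OF f]) auto
  then show ?thesis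
    using U.prob_space by (simp add: field_simps)
qed

text \<open>Repeated integration by parts lowers the degree until only traces remain. With
  \<open>a\<close> the trace of \<open>f \<circ> f\<close> and \<open>d\<close> the dimension, the
  fourth moment is 12 (a^2 + 4 tr f^4) / (d (d+2) (d+4) (d+6)) and the second is 2 a / (d (d+2));
  then tr f^4 is at most a^2.\<close>

lemma quad_form_uniform_sphere_fourth_moment:
  fixes f :: "real^'d \<Rightarrow> real^'d"
  assumes f: "bounded_linear f" and adj: "\<And>x y. x \<bullet> f y = f x \<bullet> y" and tr: "op_trace f = 0"
  shows "(\<integral>x. (x \<bullet> f x) ^ 4 \<partial>uniform_sphere) \<le> 15 * (\<integral>x. (x \<bullet> f x)\<^sup>2 \<partial>uniform_sphere)\<^sup>2"
proof -
  note [continuous_intros] = linear_continuous_on[OF f] continuous_on_compose2[OF linear_continuous_on[OF f]]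
  have ff: "bounded_linear (\<lambda>x. f (f x))" and fff: "bounded_linear (\<lambda>x. f (f (f x)))"
    and id: "bounded_linear (\<lambda>x. x)"
    using f by (auto intro: bounded_linear_compose)
  have adj2: "x \<bullet> f (f y) = f (f x) \<bullet> y" and adj3: "x \<bullet> f (f (f y)) = f (f (f x)) \<bullet> y" for x y
    by (simp_all add: adj)
  define d where "d = real CARD('d)"
  have d: "d > 0" by (simp add: d_def)
  define a where "a = op_trace (f \<circ> f)"
  \<comment> \<open>By self-adjointness \<open>q\<close>, \<open>p\<close>, \<open>r\<close>,
    \<open>w\<close> are the quadratic forms of the first four powers of \<open>f\<close>.\<close>
  define q where "q = (\<lambda>x. x \<bullet> f x)"
  define p where "p = (\<lambda>x. f x \<bullet> f x)"
  define r where "r = (\<lambda>x. f (f x) \<bullet> f x)"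
  define w where "w = (\<lambda>x. f (f x) \<bullet> f (f x))"
  have eqs: "x \<bullet> f x = q x" "f x \<bullet> x = q x" "x \<bullet> f (f x) = p x" "f (f x) \<bullet> x = p x"
    "f x \<bullet> f x = p x" "f x \<bullet> f (f x) = r x" "f (f x) \<bullet> f x = r x" "x \<bullet> f (f (f x)) = r x"
    "f (f (f x)) \<bullet> x = r x" "f (f x) \<bullet> f (f x) = w x" "f (f (f x)) \<bullet> f x = w x"
    "f x \<bullet> f (f (f x)) = w x" "q (f x) = r x" "p (f x) = w x"
    "x \<bullet> f (f (f (f x))) = w x" for x
    unfolding q_def p_def r_def w_def by (metis adj inner_commute)+
  let ?E = "\<lambda>g. \<integral>x. g x \<partial>(uniform_sphere :: (real^'d) measure)"
  have cont [continuous_intros]: "continuous_on UNIV q" "continuous_on UNIV p"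
    "continuous_on UNIV r" "continuous_on UNIV w"
    unfolding q_def p_def r_def w_def by (auto intro!: continuous_intros)
  have norm_eq: "?E g = ?E h" if "\<And>x. norm x = 1 \<Longrightarrow> g x = h x"
    "continuous_on UNIV g" "continuous_on UNIV h" for g h
  proof (rule integral_cong_AE)
    show "AE x in uniform_sphere. g x = h x"
      using AE_norm_uniform_sphere by eventually_elim (rule that)
  qed (use that(2,3)[THEN borel_measurable_continuous_onI] in simp_all)
  have xx: "x \<bullet> x = 1" if "norm x = 1" for x :: "real^'d"
    using that by (simp add: norm_eq_1)
  note quad = integral_uniform_sphere_quad_forms[where 'd='d, folded d_def]
  have E4: "(d + 6) * ?E (\<lambda>x. q x ^ 4) = 6 * ?E (\<lambda>x. (q x)\<^sup>2 * p x)"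
  proof -
    have "(d + 6) * ?E (\<lambda>x. q x * (q x * q x * q x)) =
        2 * ?E (\<lambda>x. p x * q x * q x + q x * p x * q x + q x * q x * p x)"
      using quad[OF f f f f adj adj adj] by (simp add: tr eqs)
    also have "(\<lambda>x. p x * q x * q x + q x * p x * q x + q x * q x * p x) =
        (\<lambda>x. 3 * ((q x)\<^sup>2 * p x))"
      by (simp add: fun_eq_iff power2_eq_square)
    also have "(\<lambda>x. q x * (q x * q x * q x)) = (\<lambda>x. q x ^ 4)"
      by (simp add: fun_eq_iff power4_eq_xxxx)
    finally show ?thesis
      by simp
  qed
  \<comment> \<open>The identity map pads the product to three forms, since
    \<open>x \<bullet> x = 1\<close> on the sphere. The padding reproduces the left-hand integral on
    the right, which lowers \<open>d + 6\<close> to \<open>d + 4\<close>.\<close>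
  have "(d + 6) * ?E (\<lambda>x. (q x)\<^sup>2 * p x) = 2 * ?E (\<lambda>x. (p x)\<^sup>2 + q x * r x + (q x)\<^sup>2 * p x)"
  proof -
    have "(d + 6) * ?E (\<lambda>x. q x * (q x * p x * (x \<bullet> x))) =
        2 * ?E (\<lambda>x. p x * p x * (x \<bullet> x) + q x * r x * (x \<bullet> x) + q x * p x * q x)"
      using quad[OF f f ff id adj adj2] by (simp add: tr eqs)
    also have "?E (\<lambda>x. q x * (q x * p x * (x \<bullet> x))) = ?E (\<lambda>x. (q x)\<^sup>2 * p x)"
      by (rule norm_eq) (auto intro!: continuous_intros simp: xx power2_eq_square)
    also have "?E (\<lambda>x. p x * p x * (x \<bullet> x) + q x * r x * (x \<bullet> x) + q x * p x * q x) =
        ?E (\<lambda>x. (p x)\<^sup>2 + q x * r x + (q x)\<^sup>2 * p x)"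
      by (rule norm_eq) (auto intro!: continuous_intros simp: xx power2_eq_square)
    finally show ?thesis .
  qed
  also have "?E (\<lambda>x. (p x)\<^sup>2 + q x * r x + (q x)\<^sup>2 * p x) =
      ?E (\<lambda>x. (p x)\<^sup>2) + ?E (\<lambda>x. q x * r x) + ?E (\<lambda>x. (q x)\<^sup>2 * p x)"
    by (subst Bochner_Integration.integral_add;
        (intro integrable_uniform_sphere continuous_intros)?)+ simp
  finally have Eqqp: "(d + 4) * ?E (\<lambda>x. (q x)\<^sup>2 * p x) = 2 * (?E (\<lambda>x. (p x)\<^sup>2) + ?E (\<lambda>x. q x * r x))"
    by (simp add: algebra_simps)
  \<comment> \<open>Two identity maps as padding lower the factor from \<open>d + 6\<close> to
    \<open>d + 2\<close>.\<close>
  have two: "(d + 2) * ?E (\<lambda>x. (x \<bullet> g x) * (x \<bullet> h x)) = op_trace g * ?E (\<lambda>x. x \<bullet> h x) + 2 * ?E (\<lambda>x. h x \<bullet> g x)"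
    if g: "bounded_linear g" and h: "bounded_linear h" and hadj: "\<And>x y. x \<bullet> h y = h x \<bullet> y" for g h
  proof -
    note [continuous_intros] = linear_continuous_on[OF g] linear_continuous_on[OF h]
    have "(d + 6) * ?E (\<lambda>x. (x \<bullet> g x) * ((x \<bullet> h x) * (x \<bullet> x) * (x \<bullet> x))) =
        op_trace g * ?E (\<lambda>x. (x \<bullet> h x) * (x \<bullet> x) * (x \<bullet> x)) +
        2 * ?E (\<lambda>x. (h x \<bullet> g x) * (x \<bullet> x) * (x \<bullet> x) + (x \<bullet> h x) * (x \<bullet> g x) * (x \<bullet> x)
          + (x \<bullet> h x) * (x \<bullet> x) * (x \<bullet> g x))"
      by (rule quad[OF g h id id hadj]) auto
    also have "?E (\<lambda>x. (x \<bullet> g x) * ((x \<bullet> h x) * (x \<bullet> x) * (x \<bullet> x))) = ?E (\<lambda>x. (x \<bullet> g x) * (x \<bullet> h x))"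
      by (rule norm_eq) (auto intro!: continuous_intros simp: xx)
    also have "?E (\<lambda>x. (x \<bullet> h x) * (x \<bullet> x) * (x \<bullet> x)) = ?E (\<lambda>x. x \<bullet> h x)"
      by (rule norm_eq) (auto intro!: continuous_intros simp: xx)
    also have "?E (\<lambda>x. (h x \<bullet> g x) * (x \<bullet> x) * (x \<bullet> x) + (x \<bullet> h x) * (x \<bullet> g x) * (x \<bullet> x)
          + (x \<bullet> h x) * (x \<bullet> x) * (x \<bullet> g x)) = ?E (\<lambda>x. h x \<bullet> g x + 2 * ((x \<bullet> g x) * (x \<bullet> h x)))"
      by (rule norm_eq) (auto intro!: continuous_intros simp: xx)
    also have "\<dots> = ?E (\<lambda>x. h x \<bullet> g x) + ?E (\<lambda>x. 2 * ((x \<bullet> g x) * (x \<bullet> h x)))"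
      by (intro Bochner_Integration.integral_add integrable_uniform_sphere continuous_intros)
    finally show ?thesis
      by (simp add: algebra_simps)
  qed
  have Epp: "(d + 2) * ?E (\<lambda>x. (p x)\<^sup>2) = a * ?E p + 2 * ?E w"
    using two[OF ff ff adj2] by (simp add: eqs power2_eq_square a_def o_def)
  have Eqr: "(d + 2) * ?E (\<lambda>x. q x * r x) = 2 * ?E w"
    using two[OF f fff adj3] by (simp add: eqs tr)
  have Eqq: "(d + 2) * ?E (\<lambda>x. (q x)\<^sup>2) = 2 * ?E p"
    using two[OF f f adj] by (simp add: eqs tr power2_eq_square)
  have Ep: "?E p = a / d"
    using integral_uniform_sphere_quad_form[OF ff] by (simp add: eqs d_def a_def o_def)
  have "?E w = op_trace (f \<circ> f \<circ> (f \<circ> f)) / d"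
    using integral_uniform_sphere_quad_form[OF bounded_linear_compose[OF f fff]]
    by (simp add: eqs d_def o_def)
  also have "\<dots> \<le> a\<^sup>2 / d"
    using op_trace_square_of_square_le[OF adj] d by (simp add: a_def divide_right_mono)
  finally have Ew: "?E w \<le> a\<^sup>2 / d" .
  have "?E (\<lambda>x. q x ^ 4) = 12 * (a * ?E p + 4 * ?E w) / ((d + 2) * ((d + 4) * (d + 6)))"
  proof -
    have "?E (\<lambda>x. q x ^ 4) = 6 * ?E (\<lambda>x. (q x)\<^sup>2 * p x) / (d + 6)"
      using E4 d by (simp add: field_simps)
    also have "?E (\<lambda>x. (q x)\<^sup>2 * p x) = 2 * (?E (\<lambda>x. (p x)\<^sup>2) + ?E (\<lambda>x. q x * r x)) / (d + 4)"
      using Eqqp d by (simp add: field_simps)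
    also have "?E (\<lambda>x. (p x)\<^sup>2) = (a * ?E p + 2 * ?E w) / (d + 2)"
      using Epp d by (simp add: field_simps)
    also have "?E (\<lambda>x. q x * r x) = 2 * ?E w / (d + 2)"
      using Eqr d by (simp add: field_simps)
    finally show ?thesis
      using d by (simp add: mult.assoc add.commute flip: add_divide_distrib)
  qed
  also have "\<dots> \<le> 12 * (a * (a / d) + 4 * (a\<^sup>2 / d)) / ((d + 2) * ((d + 4) * (d + 6)))"
    unfolding Ep using Ew d by (intro divide_right_mono) auto
  also have "\<dots> = 60 * a\<^sup>2 / (d * (d + 2) * ((d + 4) * (d + 6)))"
    using d by (simp add: power2_eq_square)
  \<comment> \<open>Comparing \<open>(d + 4) * (d + 6)\<close> with \<open>d * (d + 2)\<close> makes
    the denominator that of the squared second moment.\<close>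
  also have "\<dots> \<le> 60 * a\<^sup>2 / (d * (d + 2) * (d * (d + 2)))"
    using d by (intro divide_left_mono mult_mono mult_pos_pos mult_nonneg_nonneg) auto
  also have "\<dots> = 15 * (2 * (a / d) / (d + 2))\<^sup>2"
    using d by (simp add: power2_eq_square)
  also have "2 * (a / d) / (d + 2) = ?E (\<lambda>x. (q x)\<^sup>2)"
    unfolding Eqq[unfolded Ep, symmetric] using d by simp
  finally show ?thesis
    by (simp add: q_def)
qed

section \<open>Sums of independent variables\<close>

lemma (in prob_space) integrable_power_bounded:
  fixes X :: "'a \<Rightarrow> real"
  assumes "random_variable borel X" and "AE x in M. \<bar>X x\<bar> \<le> B"
  shows "integrable M (\<lambda>x. X x ^ k)"
proof (rule integrable_const_bound)
  show "AE x in M. norm (X x ^ k) \<le> B ^ k"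
    using assms(2) by eventually_elim (simp add: power_abs power_mono)
qed (use assms in measurable)

lemma (in prob_space) indep_var_add_moments:
  fixes X Y :: "'a \<Rightarrow> real"
  assumes indep: "indep_var borel X borel Y"
    and intX: "\<And>k. integrable M (\<lambda>x. X x ^ k)" and intY: "\<And>k. integrable M (\<lambda>x. Y x ^ k)"
    and mean: "expectation X = 0" "expectation Y = 0"
  shows "expectation (\<lambda>x. (X x + Y x)\<^sup>2) = expectation (\<lambda>x. (X x)\<^sup>2) + expectation (\<lambda>x. (Y x)\<^sup>2)"
    and "expectation (\<lambda>x. (X x + Y x) ^ 4) = expectation (\<lambda>x. X x ^ 4) +
      6 * (expectation (\<lambda>x. (X x)\<^sup>2) * expectation (\<lambda>x. (Y x)\<^sup>2)) + expectation (\<lambda>x. Y x ^ 4)"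
proof -
  have ind: "indep_var borel (\<lambda>x. X x ^ k) borel (\<lambda>x. Y x ^ l)" for k l
    using indep_var_compose[OF indep, of "\<lambda>x. x ^ k" borel "\<lambda>x. x ^ l" borel] by (simp add: comp_def)
  have E: "expectation (\<lambda>x. X x ^ k * Y x ^ l) = expectation (\<lambda>x. X x ^ k) * expectation (\<lambda>x. Y x ^ l)"
    and I: "integrable M (\<lambda>x. X x ^ k * Y x ^ l)" for k l
    using indep_var_lebesgue_integral[OF ind intX intY] indep_var_integrable[OF ind intX intY] by auto
  have E': "expectation (\<lambda>x. X x * Y x) = 0" "expectation (\<lambda>x. X x * Y x ^ 3) = 0"
    "expectation (\<lambda>x. X x ^ 3 * Y x) = 0"
    using E[of 1 1] E[of 1 3] E[of 3 1] mean by simp_all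
  have I': "integrable M (\<lambda>x. X x * Y x)" "integrable M (\<lambda>x. X x * Y x ^ 3)"
    "integrable M (\<lambda>x. X x ^ 3 * Y x)"
    using I[of 1 1] I[of 1 3] I[of 3 1] by simp_all
  have "(\<lambda>x. (X x + Y x)\<^sup>2) = (\<lambda>x. (X x)\<^sup>2 + 2 * (X x * Y x) + (Y x)\<^sup>2)"
    by (simp add: fun_eq_iff power2_eq_square algebra_simps)
  then show "expectation (\<lambda>x. (X x + Y x)\<^sup>2) = expectation (\<lambda>x. (X x)\<^sup>2) + expectation (\<lambda>x. (Y x)\<^sup>2)"
    using I' E' intX intY by simp
  have "(\<lambda>x. (X x + Y x) ^ 4) = (\<lambda>x. X x ^ 4 + 4 * (X x ^ 3 * Y x) + 6 * ((X x)\<^sup>2 * (Y x)\<^sup>2)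
      + 4 * (X x * Y x ^ 3) + Y x ^ 4)"
    by (simp add: fun_eq_iff power2_eq_square power3_eq_cube power4_eq_xxxx algebra_simps)
  then show "expectation (\<lambda>x. (X x + Y x) ^ 4) = expectation (\<lambda>x. X x ^ 4) +
      6 * (expectation (\<lambda>x. (X x)\<^sup>2) * expectation (\<lambda>x. (Y x)\<^sup>2)) + expectation (\<lambda>x. Y x ^ 4)"
    using I' I[of 2 2] E' E[of 2 2] intX intY by simp
qed

text \<open>Adding an independent centred term creates the cross term 6 times the product of the
  variances, while the right-hand side gains \<open>2 * C\<close> times that product;
  \<open>C \<ge> 3\<close> makes this enough. Boundedness supplies all the moments used.\<close>

lemma (in prob_space) indep_vars_sum_fourth_moment_le:
  fixes X :: "'i \<Rightarrow> 'a \<Rightarrow> real"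
  assumes "finite J" and "indep_vars (\<lambda>_. borel) X J"
    and "\<And>j. j \<in> J \<Longrightarrow> AE x in M. \<bar>X j x\<bar> \<le> B j"
    and "\<And>j. j \<in> J \<Longrightarrow> expectation (X j) = 0"
    and "\<And>j. j \<in> J \<Longrightarrow> expectation (\<lambda>x. X j x ^ 4) \<le> C * (expectation (\<lambda>x. (X j x)\<^sup>2))\<^sup>2"
    and C: "C \<ge> 3"
  shows "expectation (\<lambda>x. (\<Sum>j\<in>J. X j x) ^ 4) \<le> C * (expectation (\<lambda>x. (\<Sum>j\<in>J. X j x)\<^sup>2))\<^sup>2"
  using assms(1-5)
proof (induction J rule: finite_induct)
  case empty
  then show ?case by simp
next
  case (insert i J)
  define S where "S = (\<lambda>x. \<Sum>j\<in>J. X j x)"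
  have rv: "random_variable borel (X j)" if "j \<in> insert i J" for j
    using insert.prems(1) that by (auto simp: indep_vars_def)
  then have S: "random_variable borel S"
    unfolding S_def by (intro borel_measurable_sum) auto
  have int: "integrable M (\<lambda>x. X j x ^ k)" if "j \<in> insert i J" for j k
    using rv[OF that] insert.prems(2)[OF that] by (rule integrable_power_bounded)
  have "AE x in M. \<forall>j\<in>J. \<bar>X j x\<bar> \<le> B j"
    using insert.hyps(1) insert.prems(2) by (intro AE_finite_allI) auto
  then have "AE x in M. \<bar>S x\<bar> \<le> (\<Sum>j\<in>J. B j)"
    unfolding S_def by eventually_elim (intro sum_norm_le[where f="\<lambda>j. X j _", simplified], auto)
  then have intS: "integrable M (\<lambda>x. S x ^ k)" for k
    by (rule integrable_power_bounded[OF S])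
  have indep: "indep_var borel (X i) borel S"
    unfolding S_def using insert.hyps insert.prems(1) by (rule indep_vars_sum)
  have "expectation S = 0"
    unfolding S_def using insert.prems(3) int[of _ 1] by (subst Bochner_Integration.integral_sum) auto
  note mom = indep_var_add_moments[OF indep int[of i] intS insert.prems(3)[of i] this, simplified]
  define x2 s2 where "x2 = expectation (\<lambda>x. (X i x)\<^sup>2)" and "s2 = expectation (\<lambda>x. (S x)\<^sup>2)"
  have nn: "x2 \<ge> 0" "s2 \<ge> 0"
    by (simp_all add: x2_def s2_def)
  have IH: "expectation (\<lambda>x. S x ^ 4) \<le> C * s2\<^sup>2"
    unfolding S_def s2_def using insert.prems indep_vars_subset[OF insert.prems(1)]
    by (intro insert.IH) auto
  have "expectation (\<lambda>x. (X i x + S x) ^ 4) \<le> C * x2\<^sup>2 + 6 * (x2 * s2) + C * s2\<^sup>2"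
    unfolding mom(2) using insert.prems(4)[of i] IH by (simp add: x2_def s2_def)
  also have "6 * (x2 * s2) \<le> 2 * C * (x2 * s2)"
    using C nn by (intro mult_right_mono) auto
  then have "C * x2\<^sup>2 + 6 * (x2 * s2) + C * s2\<^sup>2 \<le> C * (x2 + s2)\<^sup>2"
    by (simp add: power2_eq_square algebra_simps)
  also have "x2 + s2 = expectation (\<lambda>x. (X i x + S x)\<^sup>2)"
    unfolding mom(1) x2_def s2_def ..
  finally show ?case
    using insert.hyps by (simp add: S_def)
qed

text \<open>Multiplication by a sign is orthogonal and so preserves each marginal; by independence
  the joint law is the product of the marginals, hence is preserved too.\<close>

lemma (in prob_space) distr_indep_symmetric_sign_change:
  fixes \<xi> :: "'i \<Rightarrow> 'a \<Rightarrow> real^'d"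
  assumes J: "finite J"
    and indep: "indep_vars (\<lambda>_. borel) \<xi> J"
    and dist: "\<And>j. j \<in> J \<Longrightarrow> distr M borel (\<xi> j) = uniform_sphere"
    and g: "g \<in> borel_measurable (PiM J (\<lambda>_. borel :: (real^'d) measure))"
  shows "distr M borel (\<lambda>\<omega>. g (\<lambda>j\<in>J. sign_at s j *\<^sub>R \<xi> j \<omega>)) = distr M borel (\<lambda>\<omega>. g (\<lambda>j\<in>J. \<xi> j \<omega>))"
proof (cases "J = {}")
  case False
  have rv: "random_variable borel (\<xi> j)" if "j \<in> J" for j
    using indep that by (auto simp: indep_vars_def)
  have orth: "orthogonal_transformation (\<lambda>x. sign_at s j *\<^sub>R x :: real^'d)" for j
    by (auto simp: orthogonal_transformation_def sign_at_def linear_uminus intro: linearI)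
  have rv': "random_variable borel (\<lambda>\<omega>. sign_at s j *\<^sub>R \<xi> j \<omega>)" if "j \<in> J" for j
    using rv[OF that] by simp
  have dist': "distr M borel (\<lambda>\<omega>. sign_at s j *\<^sub>R \<xi> j \<omega>) = uniform_sphere" if "j \<in> J" for j
  proof -
    have "distr M borel (\<lambda>\<omega>. sign_at s j *\<^sub>R \<xi> j \<omega>) = distr (distr M borel (\<xi> j)) borel (\<lambda>x. sign_at s j *\<^sub>R x)"
      using rv[OF that] by (subst distr_distr) (auto simp: comp_def)
    then show ?thesis
      by (simp add: dist[OF that] uniform_sphere_rotation_invariant[OF orth])
  qed
  have indep': "indep_vars (\<lambda>_. borel) (\<lambda>j \<omega>. sign_at s j *\<^sub>R \<xi> j \<omega>) J"
    by (rule indep_vars_compose2[OF indep]) simp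
  let ?P = "PiM J (\<lambda>_. borel :: (real^'d) measure)"
  have "distr M ?P (\<lambda>\<omega>. \<lambda>j\<in>J. \<xi> j \<omega>) = PiM J (\<lambda>j. distr M borel (\<xi> j))"
    using indep indep_vars_iff_distr_eq_PiM'[OF False, where M'="\<lambda>_. borel" and X=\<xi>] rv by simp
  also have "\<dots> = PiM J (\<lambda>j. distr M borel (\<lambda>\<omega>. sign_at s j *\<^sub>R \<xi> j \<omega>))"
    by (rule PiM_cong) (auto simp: dist dist')
  also have "\<dots> = distr M ?P (\<lambda>\<omega>. \<lambda>j\<in>J. sign_at s j *\<^sub>R \<xi> j \<omega>)"
    using indep' indep_vars_iff_distr_eq_PiM'[OF False, where M'="\<lambda>_. borel" and X="\<lambda>j \<omega>. sign_at s j *\<^sub>R \<xi> j \<omega>"] rv'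
    by simp
  finally have eq: "distr (distr M ?P (\<lambda>\<omega>. \<lambda>j\<in>J. \<xi> j \<omega>)) borel g =
      distr (distr M ?P (\<lambda>\<omega>. \<lambda>j\<in>J. sign_at s j *\<^sub>R \<xi> j \<omega>)) borel g"
    by simp
  have m: "(\<lambda>\<omega>. \<lambda>j\<in>J. \<xi> j \<omega>) \<in> measurable M ?P" "(\<lambda>\<omega>. \<lambda>j\<in>J. sign_at s j *\<^sub>R \<xi> j \<omega>) \<in> measurable M ?P"
    using rv rv' by (auto intro!: measurable_restrict)
  show ?thesis
    using eq by (simp add: distr_distr[OF g m(1)] distr_distr[OF g m(2)] comp_def)
qed (auto intro!: distr_cong arg_cong[of _ _ g])

section \<open>The diagonal part of the squared norm\<close>

lemma power2_norm_matrix_vector_mult: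
  fixes A :: "real^'n^'m"
  shows "(norm (A *v x))\<^sup>2 = x \<bullet> (transpose A *v (A *v x))"
  by (metis dot_lmul_matrix inner_commute power2_norm_eq_inner vector_transpose_matrix transpose_transpose)

text \<open>Take \<open>transpose A ** A\<close> minus \<open>m\<close> times the identity. The mean
  \<open>m\<close> is the trace of the first operator divided by the dimension, so the difference is
  traceless, and on unit vectors the subtracted form is the constant \<open>m\<close>.\<close>

lemma matrix_centered_quad_form:
  fixes A :: "real^'d^'d"
  obtains f where "bounded_linear f" "\<And>x y. x \<bullet> f y = f x \<bullet> y" "op_trace f = 0"
    "\<And>x. norm x = 1 \<Longrightarrow>
      x \<bullet> f x = (norm (A *v x))\<^sup>2 - (\<integral>y. (norm (A *v y))\<^sup>2 \<partial>uniform_sphere)"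
proof
  let ?g = "\<lambda>x. transpose A *v (A *v x)"
  define m where "m = (\<integral>y. (norm (A *v y))\<^sup>2 \<partial>uniform_sphere)"
  define f where "f = (\<lambda>x. ?g x - m *\<^sub>R x)"
  have g: "bounded_linear ?g"
    by (intro bounded_linear_compose[OF matrix_vector_mul_bounded_linear] matrix_vector_mul_bounded_linear)
  show "bounded_linear f"
    unfolding f_def by (intro bounded_linear_sub g bounded_linear_scaleR_right)
  have g_adj: "x \<bullet> ?g y = ?g x \<bullet> y" for x y
    by (metis dot_lmul_matrix inner_commute vector_transpose_matrix transpose_transpose)
  then show "x \<bullet> f y = f x \<bullet> y" for x y
    by (simp add: f_def inner_diff_left inner_diff_right)
  have "op_trace f = op_trace ?g - m * CARD('d)"
    by (simp add: op_trace_def f_def inner_diff_left sum_subtractf)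
  moreover have "m = op_trace ?g / CARD('d)"
    unfolding m_def power2_norm_matrix_vector_mult by (rule integral_uniform_sphere_quad_form[OF g])
  ultimately show "op_trace f = 0"
    by simp
  show "x \<bullet> f x = (norm (A *v x))\<^sup>2 - (\<integral>y. (norm (A *v y))\<^sup>2 \<partial>uniform_sphere)" if "norm x = 1" for x
    using that unfolding m_def[symmetric]
    by (simp add: f_def inner_diff_right power2_norm_matrix_vector_mult norm_eq_1)
qed

text \<open>Each centred summand is almost surely a traceless quadratic form in a uniform vector, so
  it satisfies the fourth-moment bound with constant 15. Independence passes the bound to the sum,
  and the estimate for the positive part applies.\<close>

lemma (in prob_space) prob_diagonal_ge:
  fixes \<xi> :: "'i \<Rightarrow> 'a \<Rightarrow> real^'d" and A :: "'i \<Rightarrow> real^'d^'d"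
  assumes J: "finite J"
    and indep: "indep_vars (\<lambda>_. borel) \<xi> J"
    and dist: "\<And>j. j \<in> J \<Longrightarrow> distr M borel (\<xi> j) = uniform_sphere"
  shows "prob {\<omega> \<in> space M. (\<Sum>j\<in>J. (norm (A j *v \<xi> j \<omega>))\<^sup>2) \<ge>
    expectation (\<lambda>\<omega>. \<Sum>j\<in>J. (norm (A j *v \<xi> j \<omega>))\<^sup>2)} \<ge> (2 * sqrt 3 - 3) / 15"
proof -
  let ?U = "uniform_sphere :: (real^'d) measure"
  interpret U: prob_space ?U
    by (rule prob_space_uniform_sphere)
  define h where "h = (\<lambda>j x. (norm (A j *v x))\<^sup>2 - (\<integral>y. (norm (A j *v y))\<^sup>2 \<partial>?U))"
  have conth: "continuous_on UNIV (h j)" for j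
    unfolding h_def by (intro continuous_intros linear_continuous_on matrix_vector_mul_bounded_linear)
  have [measurable]: "h j \<in> borel_measurable borel" for j
    using conth by (rule borel_measurable_continuous_onI)
  have rv [measurable]: "random_variable borel (\<xi> j)" if "j \<in> J" for j
    using indep that by (auto simp: indep_vars_def)
  have E: "expectation (\<lambda>\<omega>. g (\<xi> j \<omega>)) = (\<integral>x. g x \<partial>?U)"
    if "g \<in> borel_measurable borel" "j \<in> J" for g :: "real^'d \<Rightarrow> real" and j
    using integral_distr[OF rv[OF that(2)] that(1)] dist[OF that(2)] by simp
  have h4: "(\<integral>x. h j x ^ 4 \<partial>?U) \<le> 15 * (\<integral>x. (h j x)\<^sup>2 \<partial>?U)\<^sup>2" for j
  proof -
    obtain f where f: "bounded_linear f" "\<And>x y. x \<bullet> f y = f x \<bullet> y" "op_trace f = 0"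
      "\<And>x. norm x = 1 \<Longrightarrow> x \<bullet> f x = h j x"
      unfolding h_def by (rule matrix_centered_quad_form[of "A j"]) blast
    have [measurable]: "f \<in> borel_measurable borel"
      using f(1) by (intro borel_measurable_continuous_onI linear_continuous_on)
    have "(\<integral>x. h j x ^ k \<partial>?U) = (\<integral>x. (x \<bullet> f x) ^ k \<partial>?U)" for k
    proof (rule integral_cong_AE)
      show "AE x in ?U. h j x ^ k = (x \<bullet> f x) ^ k"
        using AE_norm_uniform_sphere by eventually_elim (simp add: f(4))
    qed measurable
    then show ?thesis
      using quad_form_uniform_sphere_fourth_moment[OF f(1-3)] by simp
  qed
  have h1: "(\<integral>x. h j x \<partial>?U) = 0" for j
  proof -
    have "integrable ?U (\<lambda>x. (norm (A j *v x))\<^sup>2)"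
      by (intro integrable_uniform_sphere continuous_intros linear_continuous_on
          matrix_vector_mul_bounded_linear)
    then show ?thesis
      using U.prob_space by (simp add: h_def)
  qed
  have "\<exists>B. \<forall>x\<in>sphere 0 1. \<bar>h j x\<bar> \<le> B" for j
  proof -
    have "compact (h j ` sphere 0 1)"
      by (intro compact_continuous_image continuous_on_subset[OF conth]) auto
    then show ?thesis
      by (meson bounded_real compact_imp_bounded imageI)
  qed
  then obtain B where B: "\<And>j x. norm x = 1 \<Longrightarrow> \<bar>h j x\<bar> \<le> B j"
    by (metis mem_sphere_0)
  have bd: "AE \<omega> in M. \<bar>h j (\<xi> j \<omega>)\<bar> \<le> B j" if "j \<in> J" for j
  proof -
    have "AE x in distr M borel (\<xi> j). norm x = 1"
      unfolding dist[OF that] by (rule AE_norm_uniform_sphere)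
    then have "AE \<omega> in M. norm (\<xi> j \<omega>) = 1"
      using rv[OF that] by (subst (asm) AE_distr_iff) auto
    then show ?thesis
      by eventually_elim (rule B)
  qed
  define Y where "Y = (\<lambda>\<omega>. \<Sum>j\<in>J. h j (\<xi> j \<omega>))"
  have Ym [measurable]: "random_variable borel Y"
    unfolding Y_def by measurable
  have "AE \<omega> in M. \<forall>j\<in>J. \<bar>h j (\<xi> j \<omega>)\<bar> \<le> B j"
    using J bd by (intro AE_finite_allI) auto
  then have "AE \<omega> in M. \<bar>Y \<omega>\<bar> \<le> (\<Sum>j\<in>J. B j)"
    unfolding Y_def by eventually_elim (intro order_trans[OF sum_abs] sum_mono, auto)
  then have intY: "integrable M (\<lambda>\<omega>. Y \<omega> ^ k)" for k
    by (rule integrable_power_bounded[OF Ym])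
  have inth: "integrable M (\<lambda>\<omega>. h j (\<xi> j \<omega>))" if "j \<in> J" for j
    using integrable_power_bounded[OF _ bd[OF that], of 1] that by simp
  have EY: "expectation Y = 0"
    unfolding Y_def using inth by (simp add: E h1)
  have "prob {\<omega> \<in> space M. Y \<omega> \<ge> 0} \<ge> (2 * sqrt 3 - 3) / 15"
  proof (rule prob_nonneg_ge_fourth_moment)
    show "expectation (\<lambda>\<omega>. Y \<omega> ^ 4) \<le> 15 * (expectation (\<lambda>\<omega>. (Y \<omega>)\<^sup>2))\<^sup>2"
      unfolding Y_def
    proof (rule indep_vars_sum_fourth_moment_le[OF J _ bd])
      show "indep_vars (\<lambda>_. borel) (\<lambda>j \<omega>. h j (\<xi> j \<omega>)) J"
        by (rule indep_vars_compose2[OF indep]) simp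
      show "expectation (\<lambda>\<omega>. h j (\<xi> j \<omega>) ^ 4) \<le> 15 * (expectation (\<lambda>\<omega>. (h j (\<xi> j \<omega>))\<^sup>2))\<^sup>2"
        if "j \<in> J" for j
        using h4[of j] E[OF _ that, of "\<lambda>x. h j x ^ 4"] E[OF _ that, of "\<lambda>x. (h j x)\<^sup>2"] by simp
    qed (auto simp: E h1)
  qed (use intY[of 1] intY EY in auto)
  moreover have "Y \<omega> = (\<Sum>j\<in>J. (norm (A j *v \<xi> j \<omega>))\<^sup>2) -
      expectation (\<lambda>\<omega>. \<Sum>j\<in>J. (norm (A j *v \<xi> j \<omega>))\<^sup>2)" for \<omega>
  proof -
    have "(\<Sum>j\<in>J. (norm (A j *v \<xi> j \<omega>))\<^sup>2) = Y \<omega> + (\<Sum>j\<in>J. \<integral>y. (norm (A j *v y))\<^sup>2 \<partial>?U)" for \<omega>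
      by (simp add: Y_def h_def sum_subtractf)
    then show ?thesis
      using intY[of 1] EY by (simp add: prob_space)
  qed
  ultimately show ?thesis
    by simp
qed

theorem theorem2:
  fixes M :: "'a measure"
    and \<xi> :: "nat \<Rightarrow> 'a \<Rightarrow> real ^ 'd"
  assumes "prob_space M"
    and "prob_space.indep_vars M (\<lambda>_. borel) \<xi> {1..}"
    and "\<And>j. j \<ge> 1 \<Longrightarrow> distr M borel (\<xi> j) = uniform_sphere"
  shows "c_const M \<xi> \<ge> (7 - 4 * sqrt 3) / 75"
  unfolding c_const_def
proof (rule cINF_greatest)
  fix z :: "nat \<times> (nat \<Rightarrow> real^'d^'d)"
  assume "z \<in> {1..} \<times> UNIV"
  obtain n A where z: "z = (n, A)" by (cases z)
  interpret prob_space M by (rule assms(1))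
  define J where "J = {1..n}"
  have J: "finite J" by (simp add: J_def)
  have indep: "indep_vars (\<lambda>_. borel) \<xi> J"
    by (rule indep_vars_subset[OF assms(2)]) (auto simp: J_def)
  have dist: "distr M borel (\<xi> j) = uniform_sphere" if "j \<in> J" for j
    using that by (intro assms(3)) (auto simp: J_def)
  have rv [measurable]: "random_variable borel (\<xi> j)" if "j \<in> J" for j
    using indep that by (auto simp: indep_vars_def)
  have [measurable]: "(\<lambda>x. A j *v x) \<in> borel_measurable borel" for j
    by (intro borel_measurable_continuous_onI linear_continuous_on matrix_vector_mul_bounded_linear)
  define \<kappa> :: real where "\<kappa> = (2 * sqrt 3 - 3) / 15"
  define v where "v = (\<lambda>\<omega> j. A j *v \<xi> j \<omega>)"
  have [measurable]: "random_variable borel (\<lambda>\<omega>. v \<omega> j)" if "j \<in> J" for j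
    unfolding v_def using that by measurable
  define N where "N = (\<lambda>\<omega>. norm (\<Sum>j\<in>J. v \<omega> j))"
  define Ns where "Ns = (\<lambda>s \<omega>. norm (rad_sum J (v \<omega>) s))"
  define Q where "Q = (\<lambda>\<omega>. \<Sum>j\<in>J. (norm (v \<omega> j))\<^sup>2)"
  have meas [measurable]: "random_variable borel N" "random_variable borel (Ns s)"
    "random_variable borel Q" for s
    unfolding N_def Ns_def Q_def rad_sum_def by measurable
  \<comment> \<open>The matrices commute with the signs, so signing the vectors
    \<open>A j *v \<xi> j \<omega>\<close> is the same as signing the
    \<open>\<xi> j \<omega>\<close>.\<close>
  have same_dist: "distr M borel (Ns s) = distr M borel N" for s
  proof -
    let ?g = "\<lambda>x. norm (\<Sum>j\<in>J. A j *v x j)"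
    have "?g \<in> borel_measurable (PiM J (\<lambda>_. borel))"
      by measurable
    from distr_indep_symmetric_sign_change[OF J indep dist this, of s] show ?thesis
      unfolding Ns_def N_def rad_sum_def v_def
      by (simp add: matrix_vector_mult_scaleR)
  qed
  have Ns_sq: "(Ns s \<omega>)\<^sup>2 = Q \<omega> + rad_chaos J (v \<omega>) s" for s \<omega>
    by (simp add: Ns_def Q_def rad_chaos_def)
  have intN: "integrable M (\<lambda>\<omega>. (N \<omega>)\<^sup>2)"
  proof -
    have "AE \<omega> in M. \<forall>j\<in>J. norm (\<xi> j \<omega>) = 1"
    proof (intro AE_finite_allI J)
      fix j assume j: "j \<in> J"
      have "AE x in distr M borel (\<xi> j). norm x = 1"
        unfolding dist[OF j] by (rule AE_norm_uniform_sphere)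
      then show "AE \<omega> in M. norm (\<xi> j \<omega>) = 1"
        using rv[OF j] by (subst (asm) AE_distr_iff) auto
    qed
    then have "AE \<omega> in M. \<bar>N \<omega>\<bar> \<le> (\<Sum>j\<in>J. onorm ((*v) (A j)))"
    proof eventually_elim
      case (elim \<omega>)
      have "norm (v \<omega> j) \<le> onorm ((*v) (A j))" if "j \<in> J" for j
        using onorm[OF matrix_vector_mul_bounded_linear, of "A j" "\<xi> j \<omega>"] elim that by (simp add: v_def)
      then show ?case
        unfolding N_def by (simp add: sum_norm_le)
    qed
    then show ?thesis
      by (intro integrable_power_bounded) auto
  qed
  have intNs: "integrable M (\<lambda>\<omega>. (Ns s \<omega>)\<^sup>2)" and ENs: "expectation (\<lambda>\<omega>. (Ns s \<omega>)\<^sup>2) = expectation (\<lambda>\<omega>. (N \<omega>)\<^sup>2)" for s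
  proof -
    have sq: "(\<lambda>x::real. x\<^sup>2) \<in> borel_measurable borel" by measurable
    show "integrable M (\<lambda>\<omega>. (Ns s \<omega>)\<^sup>2)"
      using integrable_distr_eq[OF meas(2) sq, of s] integrable_distr_eq[OF meas(1) sq] intN
      by (simp add: same_dist)
    show "expectation (\<lambda>\<omega>. (Ns s \<omega>)\<^sup>2) = expectation (\<lambda>\<omega>. (N \<omega>)\<^sup>2)"
      using integral_distr[OF meas(2) sq, of s] integral_distr[OF meas(1) sq]
      by (simp add: same_dist)
  qed
  \<comment> \<open>The chaos averages to zero over the signs, so \<open>Q\<close> is the sign
    average of the squared norms, all of which have the same expectation. Thus the threshold
    \<open>V\<close> is also the mean of the diagonal part.\<close>
  have EQ: "expectation Q = expectation (\<lambda>\<omega>. (N \<omega>)\<^sup>2)"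
  proof -
    have "Q \<omega> = sign_avg J (\<lambda>s. (Ns s \<omega>)\<^sup>2)" for \<omega>
      using J by (simp add: Ns_sq sign_avg_rad_chaos)
    then have "expectation Q = expectation (\<lambda>\<omega>. sign_avg J (\<lambda>s. (Ns s \<omega>)\<^sup>2))"
      by presburger
    also have "\<dots> = sign_avg J (\<lambda>s. expectation (\<lambda>\<omega>. (Ns s \<omega>)\<^sup>2))"
      unfolding sign_avg_def using intNs by (simp add: Bochner_Integration.integral_sum)
    finally show ?thesis
      using J by (simp add: ENs)
  qed
  define V where "V = expectation (\<lambda>\<omega>. (N \<omega>)\<^sup>2)"
  have V: "V \<ge> 0" by (simp add: V_def)
  have PQ: "\<kappa> \<le> prob {\<omega> \<in> space M. Q \<omega> \<ge> V}"
    using prob_diagonal_ge[OF J indep dist, of A] EQ by (simp add: \<kappa>_def V_def Q_def v_def)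
  have \<kappa>: "\<kappa> > 0"
  proof -
    have "sqrt 3 > (3/2::real)"
      by (rule real_less_rsqrt) (simp add: power2_eq_square)
    then show ?thesis by (simp add: \<kappa>_def)
  qed
  \<comment> \<open>The signs are averaged first, at fixed \<open>\<omega>\<close>: when
    \<open>Q \<omega> \<ge> V\<close>, at least a proportion \<open>\<kappa>\<close> of them makes
    the chaos nonnegative, and then \<open>Ns s \<omega> \<ge> sqrt V\<close>. Exchanging the
    average with the expectation leaves probabilities that are all equal to the one for
    \<open>N\<close>.\<close>
  have "\<kappa> * prob {\<omega> \<in> space M. Q \<omega> \<ge> V} = expectation (\<lambda>\<omega>. \<kappa> * indicator {\<omega> \<in> space M. Q \<omega> \<ge> V} \<omega>)"
    by simp
  also have "\<dots> \<le> expectation (\<lambda>\<omega>. sign_avg J (\<lambda>s. indicator {\<omega> \<in> space M. Ns s \<omega> \<ge> sqrt V} \<omega>))"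
  proof (rule integral_mono)
    fix \<omega> assume \<omega>: "\<omega> \<in> space M"
    show "\<kappa> * indicator {\<omega> \<in> space M. Q \<omega> \<ge> V} \<omega> \<le>
        sign_avg J (\<lambda>s. indicator {\<omega> \<in> space M. Ns s \<omega> \<ge> sqrt V} \<omega>)"
    proof (cases "Q \<omega> \<ge> V")
      case True
      have "\<kappa> * 2 ^ card J \<le> card {s \<in> Pow J. rad_chaos J (v \<omega>) s \<ge> 0}"
        unfolding \<kappa>_def by (rule card_rad_chaos_nonneg_ge[OF J])
      also have "\<dots> \<le> card {s \<in> Pow J. Ns s \<omega> \<ge> sqrt V}"
      proof -
        have "Ns s \<omega> \<ge> sqrt V" if "rad_chaos J (v \<omega>) s \<ge> 0" for s
          using that True Ns_sq[of s \<omega>] by (intro real_le_lsqrt) (auto simp: Ns_def)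
        then show ?thesis
          using J by (intro of_nat_mono card_mono) auto
      qed
      also have "\<dots> = (\<Sum>s\<in>Pow J. indicator {\<omega> \<in> space M. Ns s \<omega> \<ge> sqrt V} \<omega>)"
        using J \<omega> by (simp add: indicator_def sum.If_cases Int_def)
      finally show ?thesis
        using True \<omega> by (simp add: sign_avg_def field_simps)
    qed (auto intro: sign_avg_nonneg)
  qed (auto simp: sign_avg_def less_top[symmetric]
      intro!: integrable_divide Bochner_Integration.integrable_sum integrable_real_indicator integrable_mult_right)
  also have "\<dots> = sign_avg J (\<lambda>s. prob {\<omega> \<in> space M. Ns s \<omega> \<ge> sqrt V})"
    unfolding sign_avg_def by (simp add: Bochner_Integration.integral_sum less_top[symmetric] integrable_real_indicator)
  also have "\<dots> = prob {\<omega> \<in> space M. N \<omega> \<ge> sqrt V}"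
  proof -
    have "prob {\<omega> \<in> space M. Ns s \<omega> \<ge> sqrt V} = prob {\<omega> \<in> space M. N \<omega> \<ge> sqrt V}" for s
    proof -
      have "prob {\<omega> \<in> space M. X \<omega> \<ge> sqrt V} = measure (distr M borel X) {sqrt V..}"
        if "random_variable borel X" for X
        using that by (subst measure_distr) (auto intro!: arg_cong[where f=prob])
      then show ?thesis
        by (simp add: same_dist meas)
    qed
    then show ?thesis
      using J by simp
  qed
  finally have "\<kappa> * \<kappa> \<le> prob {\<omega> \<in> space M. N \<omega> \<ge> sqrt V}"
    using mult_left_mono[OF PQ, of \<kappa>] \<kappa> by linarith
  moreover have "\<kappa> * \<kappa> = (7 - 4 * sqrt 3) / 75"
    by (simp add: \<kappa>_def field_simps)
  ultimately show "(7 - 4 * sqrt 3) / 75 \<le> (case z of (n, A) \<Rightarrow>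
      prob {\<omega> \<in> space M. norm (\<Sum>j=1..n. A j *v \<xi> j \<omega>) \<ge>
        sqrt (\<integral>\<omega>'. (norm (\<Sum>j=1..n. A j *v \<xi> j \<omega>'))\<^sup>2 \<partial>M)})"
    by (simp add: z N_def V_def v_def J_def)
qed auto

end
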